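(* Let $T$ be a monoid, $E$ a semilattice and $\mathcal{G}$ a labelled directed graph with vertex set $E$ and edges labelled by elements of $T$ which has compatible restrictions and corestrictions. Let $E\rtimes_{\mathcal G} T$ be the algebra $(\widetilde{\mathcal C}(\mathcal G);\cdot\,,{}^+,{}^* )$ described in the context. Then: (1) $(E\rtimes_{\mathcal G} T,\cdot,{}^+,{}^* )$ is an Ehresmann semigroup. (2) $P(E\rtimes_{\mathcal G} T)=\{[(e,1,e)]\colon e\in E\}$ and $P(E\rtimes_{\mathcal G} T)\simeq E$ via the map $[(e,1,e)]\mapsto e$. It follows that $E\rtimes_{\mathcal G} T$ is a monoid if and only if $E$ has a maximum element. (3) Let $c,d\in E\rtimes_{\mathcal G} T$. If $c\mathrel{\sigma} d$ then $\mathbf{l}(c)=\mathbf{l}(d)$. (4) Let $c,d\in E\rtimes_{\mathcal G} T$. Then $c\leq_l d$ (respectively $c\leq_r d$) if and only if there is some $e\leq \mathbf{d}(d)$ (respectively $f\leq\mathbf{r}(d)$) such that $c={}_e|d$ (respectively $c=d|_f$). Consequently, $c\leq d$ holds if and only if there are some $e\leq\mathbf{d}(d)$ and $f\leq\mathbf{r}({}_e|d)$ such that $c=({}_e|d)|_f$. (5) If for all $c,d\in E\rtimes_{\mathcal G} T$ the relation $c\mathrel{\sigma} d$ holds if and only if $\mathbf{l}(c)=\mathbf{l}(d)$, then $E\rtimes_{\mathcal G} T$ is proper with the proper generating ideal $Y=\{[(e,s,f)]\colon (e,s,f)\in\mathrm{E}(\mathcal G)\}$, and $(E\rtimes_{\mathcal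 G} T)/\sigma\simeq T$ as monoids.
   Context: **Ehresmann semigroups.** An Ehresmann semigroup is an algebra $(S;\cdot\,,{}^+,{}^* )$ with $(S;\cdot)$ a semigroup and unary operations ${}^+,{}^*$ satisfying $x^+x=x$, $(x^+y^+)^+=x^+y^+=y^+x^+$, $(xy)^+=(xy^+)^+$, $xx^*=x$, $(x^*y^* )^*=x^*y^*=y^*x^*$, $(xy)^*=(x^*y)^*$, $(x^+)^*=x^+$, $(x^* )^+=x^*$. $P(S)=\{s^+\colon s\in S\}=\{s^*\colon s\in S\}$ is the semilattice of projections, with $e\le f$ iff $e=ef$. For $a,b\in S$: $a\leq_l b$ iff $a=eb$ for some $e\in P(S)$; $a\leq_r b$ iff $a=be$ for some $e\in P(S)$; $a\leq b$ (natural partial order) iff $a=ebf$ for some $e,f\in P(S)$. $\sigma$ is the minimum congruence on $S$ identifying all elements of $P(S)$. **Proper Ehresmann semigroups.** A matching factorization of $s\in S$ is a tuple $(s_1,\dots,s_n)$ of elements of $S$, $n\ge1$, with $s=s_1\cdots s_n$ and $s_i^*=s_{i+1}^+$ for $1\le i\le n-1$. An element $s$ is proper if for all $t\in S$: $t^+=s^+$, $t^*=s^*$ and $t\mathrel{\sigma}s$ imply $t=s$. A matching factorization $(s_1,\dots,s_n)$ is into a product of proper elements (respectively of elements of a subset $Y\subseteq S$) if all $s_i$ are proper (respectively belong to $Y$). If $(s_1,\dots,s_n)$ is a matching factorization of $s$ into a product of proper elements and $i\le j$ are such that $t=s_i\cdots s_j$ is a proper element of $S$, then $(s_1,\dots,s_{i-1},t,s_{j+1},\dots,s_n)$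 is also a matching factorization of $s$ into a product of proper elements, and one writes $(s_1,\dots,s_n)\to(s_1,\dots,s_{i-1},t,s_{j+1},\dots,s_n)$. Two matching factorizations of $s$ into products of proper elements are equivalent if one can be obtained from the other by finitely many applications of the relation $\to$ or its inverse. $S$ is proper if it has an order ideal $Y$ with respect to $\leq$ (called a proper generating ideal) such that $P(S)\subseteq Y$, all elements of $Y$ are proper, and each $s\in S$ admits a unique, up to equivalence, matching factorization as a product of elements of $Y$. **Labelled directed graphs with compatible restrictions and corestrictions.** Let $E$ be a semilattice ($e\le f$ iff $ef=e$) and $T$ a monoid with identity $1$. A labelled directed graph $\mathcal G$ with vertex set $E$ and edges labelled by elements of $T$ has an edge set $\mathrm{E}(\mathcal G)\subseteq E\times T\times E$; the edge $c=(e,t,f)$ has initial vertex $\mathbf d(c)=e$, terminal vertex $\mathbf r(c)=f$ and label $\mathbf l(c)=t$. It is required that $(e,1,e)\in \mathrm{E}(\mathcal G)$ for every $e\in E$, and that for every $t\in T$ there is a directed path in $\mathcal G$ labelled by $t$ (the label of a path is the product of the labels of its consecutive edges). $\mathcal G$ has restrictions if for every $(e,t,f)\in\mathrm E(\mathcal G)$ and $g\le e$ there is given an edge ${}_g|(e,t,f)$ such that: (R1) ${}_g|(e,t,f)=(g,t,f')$ for some $f'\le f$; (R2) ${}_e|(e,t,f)=(e,t,f)$; (R3) if $h\le g\le e$ then ${}_h|({}_g|(e,t,f))={}_h|(e,t,f)$; (R4) if $n\ge2$, $p_i=(e_{i-1},t_i,e_i)\in\mathrm E(\mathcal G)$ for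 $1\le i\le n$, $(e_0,t_1\cdots t_n,e_n)\in\mathrm E(\mathcal G)$, $e_0'\le e_0$, and $e_i'=\mathbf r({}_{e_{i-1}'}|p_i)$ for $1\le i\le n$, then ${}_{e_0'}|(e_0,t_1\cdots t_n,e_n)=(e_0',t_1\cdots t_n,e_n')$; (R5) if $f\le e$ then ${}_f|(e,1,e)=(f,1,f)$. Dually, $\mathcal G$ has corestrictions if for every $(e,t,f)\in\mathrm E(\mathcal G)$ and $g\le f$ there is given an edge $(e,t,f)|_g$ such that: (CR1) $(e,t,f)|_g=(e',t,g)$ for some $e'\le e$; (CR2) $(e,t,f)|_f=(e,t,f)$; (CR3) if $h\le g\le f$ then $((e,t,f)|_g)|_h=(e,t,f)|_h$; (CR4) if $n\ge2$, $p_i=(e_{i-1},t_i,e_i)\in\mathrm E(\mathcal G)$ for $1\le i\le n$, $(e_0,t_1\cdots t_n,e_n)\in\mathrm E(\mathcal G)$, $e_n'\le e_n$, and $e_{i-1}'=\mathbf d(p_i|_{e_i'})$ for $i=n,\dots,1$, then $(e_0,t_1\cdots t_n,e_n)|_{e_n'}=(e_0',t_1\cdots t_n,e_n')$; (CR5) if $f\le e$ then $(e,1,e)|_f=(f,1,f)$. Restrictions and corestrictions are compatible if (C) for every $c=(e,t,f)\in\mathrm E(\mathcal G)$, $g\le e$, $h\le f$: $({}_g|c)|_{\mathbf r({}_g|c)h}={}_{\mathbf d(c|_h)g}|(c|_h)=(g\,\mathbf d(c|_h),t,\mathbf r({}_g|c)h)$. **The algebra $E\rtimes_{\mathcal G}T$.**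 $\mathcal C(\mathcal G)$ is the semicategory of non-empty directed paths in $\mathcal G$ (objects: elements of $E$; composition: concatenation). For a path $p=p_1\cdots p_n$ with edges $p_i=(e_{i-1},t_i,e_i)$ put $\mathbf d(p)=e_0$, $\mathbf r(p)=e_n$, $\mathbf l(p)=t_1\cdots t_n$. For $e_0'\le e_0$, the restriction ${}_{e_0'}|p$ is the path $({}_{e_0'}|p_1)({}_{e_1'}|p_2)\cdots({}_{e_{n-1}'}|p_n)$ with $e_i'=\mathbf r({}_{e_{i-1}'}|p_i)$; for $e_n'\le e_n$, the corestriction $p|_{e_n'}$ is the path $(p_1|_{e_1'})\cdots(p_n|_{e_n'})$ with $e_{i-1}'=\mathbf d(p_i|_{e_i'})$. Let $\sim$ be the congruence on $\mathcal C(\mathcal G)$ generated by all pairs $(p_1\cdots p_n,\,(e_0,t_1\cdots t_n,e_n))$ with $n\ge2$, $p_i=(e_{i-1},t_i,e_i)\in\mathrm E(\mathcal G)$ and $(e_0,t_1\cdots t_n,e_n)\in\mathrm E(\mathcal G)$; let $\widetilde{\mathcal C}(\mathcal G)=\mathcal C(\mathcal G)/{\sim}$ (a category) and $[p]$ the $\sim$-class of $p$. The maps $\mathbf d,\mathbf r,\mathbf l$ and restriction, corestriction are well defined on classes: ${}_e|[p]=[{}_e|p]$, $[p]|_f=[p|_f]$. $E\rtimes_{\mathcal G}T$ is the set of arrows of $\widetilde{\mathcal C}(\mathcal G)$ with operations $c\cdot d=\big(c|_{\mathbf r(c)\mathbf d(d)}\big)\big({}_{\mathbf r(c)\mathbf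 d(d)}|d\big)$ (the product on the right being composition in $\widetilde{\mathcal C}(\mathcal G)$), $c^+=[(\mathbf d(c),1,\mathbf d(c))]$, $c^*=[(\mathbf r(c),1,\mathbf r(c))]$. *)

theory Defs
  imports "HOL-Algebra.Group"
begin

section \<open>Ehresmann semigroups\<close>

text \<open>
  \<open>lproj S x\<close> is $x^+$ and \<open>rproj S x\<close> is $x^*$.
\<close>

record 'a biunary = "'a partial_object" +
  bmult :: "'a \<Rightarrow> 'a \<Rightarrow> 'a" (infixl "\<odot>\<index>" 70)
  lproj :: "'a \<Rightarrow> 'a"
  rproj :: "'a \<Rightarrow> 'a"

locale ehresmann_semigroup =
  fixes S :: "('a, 'm) biunary_scheme" (structure)
  assumes bmult_closed: "x \<in> carrier S \<Longrightarrow> y \<in> carrier S \<Longrightarrow> x \<odot> y \<in> carrier S"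
    and lproj_closed: "x \<in> carrier S \<Longrightarrow> lproj S x \<in> carrier S"
    and rproj_closed: "x \<in> carrier S \<Longrightarrow> rproj S x \<in> carrier S"
    and bmult_assoc: "x \<in> carrier S \<Longrightarrow> y \<in> carrier S \<Longrightarrow> z \<in> carrier S \<Longrightarrow>
          (x \<odot> y) \<odot> z = x \<odot> (y \<odot> z)"
    and lproj_bmult: "x \<in> carrier S \<Longrightarrow> lproj S x \<odot> x = x"
    and lproj_lproj: "x \<in> carrier S \<Longrightarrow> y \<in> carrier S \<Longrightarrow>
          lproj S (lproj S x \<odot> lproj S y) = lproj S x \<odot> lproj S y"
    and lproj_comm: "x \<in> carrier S \<Longrightarrow> y \<in> carrier S \<Longrightarrow>
          lproj S x \<odot> lproj S y = lproj S y \<odot> lproj S x"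
    and lproj_cong: "x \<in> carrier S \<Longrightarrow> y \<in> carrier S \<Longrightarrow>
          lproj S (x \<odot> y) = lproj S (x \<odot> lproj S y)"
    and bmult_rproj: "x \<in> carrier S \<Longrightarrow> x \<odot> rproj S x = x"
    and rproj_rproj: "x \<in> carrier S \<Longrightarrow> y \<in> carrier S \<Longrightarrow>
          rproj S (rproj S x \<odot> rproj S y) = rproj S x \<odot> rproj S y"
    and rproj_comm: "x \<in> carrier S \<Longrightarrow> y \<in> carrier S \<Longrightarrow>
          rproj S x \<odot> rproj S y = rproj S y \<odot> rproj S x"
    and rproj_cong: "x \<in> carrier S \<Longrightarrow> y \<in> carrier S \<Longrightarrow>
          rproj S (x \<odot> y) = rproj S (rproj S x \<odot> y)"
    and rproj_of_lproj: "x \<in> carrier S \<Longrightarrow> rproj S (lproj S x) = lproj S x"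
    and lproj_of_rproj: "x \<in> carrier S \<Longrightarrow> lproj S (rproj S x) = rproj S x"

definition projections :: "('a, 'm) biunary_scheme \<Rightarrow> 'a set" where
  "projections S = lproj S ` carrier S"

definition le_l :: "('a, 'm) biunary_scheme \<Rightarrow> 'a \<Rightarrow> 'a \<Rightarrow> bool" where
  "le_l S a b \<longleftrightarrow> (\<exists>e\<in>projections S. a = e \<odot>\<^bsub>S\<^esub> b)"

definition le_r :: "('a, 'm) biunary_scheme \<Rightarrow> 'a \<Rightarrow> 'a \<Rightarrow> bool" where
  "le_r S a b \<longleftrightarrow> (\<exists>e\<in>projections S. a = b \<odot>\<^bsub>S\<^esub> e)"

definition le_nat :: "('a, 'm) biunary_scheme \<Rightarrow> 'a \<Rightarrow> 'a \<Rightarrow> bool" where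
  "le_nat S a b \<longleftrightarrow> (\<exists>e\<in>projections S. \<exists>f\<in>projections S. a = e \<odot>\<^bsub>S\<^esub> b \<odot>\<^bsub>S\<^esub> f)"

definition congruence :: "('a, 'm) biunary_scheme \<Rightarrow> ('a \<times> 'a) set \<Rightarrow> bool" where
  "congruence S \<rho> \<longleftrightarrow> equiv (carrier S) \<rho> \<and>
     (\<forall>a b c d. (a, b) \<in> \<rho> \<longrightarrow> (c, d) \<in> \<rho> \<longrightarrow> (a \<odot>\<^bsub>S\<^esub> c, b \<odot>\<^bsub>S\<^esub> d) \<in> \<rho>) \<and>
     (\<forall>a b. (a, b) \<in> \<rho> \<longrightarrow> (lproj S a, lproj S b) \<in> \<rho> \<and> (rproj S a, rproj S b) \<in> \<rho>)"

definition sigma :: "('a, 'm) biunary_scheme \<Rightarrow> ('a \<times> 'a) set" where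
  "sigma S = \<Inter>{\<rho>. congruence S \<rho> \<and> projections S \<times> projections S \<subseteq> \<rho>}"

text \<open>
  The monoid \<open>S / \<sigma>\<close>. All projections of \<open>S\<close> lie in one \<open>\<sigma>\<close>-class, which is its identity.
\<close>

definition sigma_quotient :: "('a, 'm) biunary_scheme \<Rightarrow> 'a set monoid" where
  "sigma_quotient S =
     \<lparr>carrier = carrier S // sigma S,
      mult = (\<lambda>A B. \<Union>a\<in>A. \<Union>b\<in>B. sigma S `` {a \<odot>\<^bsub>S\<^esub> b}),
      one = sigma S `` projections S\<rparr>"

definition is_monoid :: "('a, 'm) biunary_scheme \<Rightarrow> bool" where
  "is_monoid S \<longleftrightarrow> (\<exists>u. monoid \<lparr>carrier = carrier S, mult = bmult S, one = u\<rparr>)"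


section \<open>Proper Ehresmann semigroups\<close>

definition proper_elements :: "('a, 'm) biunary_scheme \<Rightarrow> 'a set" where
  "proper_elements S = {s \<in> carrier S. \<forall>t\<in>carrier S.
     lproj S t = lproj S s \<and> rproj S t = rproj S s \<and> (t, s) \<in> sigma S \<longrightarrow> t = s}"

text \<open>The product of a non-empty list of elements.\<close>

definition list_product :: "('a, 'm) biunary_scheme \<Rightarrow> 'a list \<Rightarrow> 'a" where
  "list_product S xs = foldl (bmult S) (hd xs) (tl xs)"

definition matching_factorization :: "('a, 'm) biunary_scheme \<Rightarrow> 'a \<Rightarrow> 'a list \<Rightarrow> bool" where
  "matching_factorization S s xs \<longleftrightarrow>
     xs \<noteq> [] \<and> set xs \<subseteq> carrier S \<and> s = list_product S xs \<and>
     successively (\<lambda>a b. rproj S a = lproj S b) xs"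

definition matching_factorization_into ::
    "('a, 'm) biunary_scheme \<Rightarrow> 'a set \<Rightarrow> 'a \<Rightarrow> 'a list \<Rightarrow> bool" where
  "matching_factorization_into S Y s xs \<longleftrightarrow> matching_factorization S s xs \<and> set xs \<subseteq> Y"

definition factorization_step :: "('a, 'm) biunary_scheme \<Rightarrow> 'a \<Rightarrow> 'a list \<Rightarrow> 'a list \<Rightarrow> bool" where
  "factorization_step S s xs ys \<longleftrightarrow>
     matching_factorization_into S (proper_elements S) s xs \<and>
     (\<exists>us vs ws. xs = us @ vs @ ws \<and> vs \<noteq> [] \<and> list_product S vs \<in> proper_elements S \<and>
        ys = us @ [list_product S vs] @ ws)"

definition equivalent_factorizations ::
    "('a, 'm) biunary_scheme \<Rightarrow> 'a \<Rightarrow> 'a list \<Rightarrow> 'a list \<Rightarrow> bool" where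
  "equivalent_factorizations S s = equivclp (factorization_step S s)"

definition order_ideal :: "('a, 'm) biunary_scheme \<Rightarrow> 'a set \<Rightarrow> bool" where
  "order_ideal S Y \<longleftrightarrow> Y \<subseteq> carrier S \<and> (\<forall>y\<in>Y. \<forall>x\<in>carrier S. le_nat S x y \<longrightarrow> x \<in> Y)"

definition proper_generating_ideal :: "('a, 'm) biunary_scheme \<Rightarrow> 'a set \<Rightarrow> bool" where
  "proper_generating_ideal S Y \<longleftrightarrow>
     order_ideal S Y \<and> projections S \<subseteq> Y \<and> Y \<subseteq> proper_elements S \<and>
     (\<forall>s\<in>carrier S.
        (\<exists>xs. matching_factorization_into S Y s xs) \<and>
        (\<forall>xs ys. matching_factorization_into S Y s xs \<longrightarrow> matching_factorization_into S Y s ys \<longrightarrow>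
           equivalent_factorizations S s xs ys))"

definition proper_ehresmann_semigroup :: "('a, 'm) biunary_scheme \<Rightarrow> bool" where
  "proper_ehresmann_semigroup S \<longleftrightarrow>
     ehresmann_semigroup S \<and> (\<exists>Y. proper_generating_ideal S Y)"


section \<open>Labelled directed graphs with restrictions and corestrictions\<close>

text \<open>
  The semilattice \<open>E\<close> is a type of class \<^class>\<open>semilattice_inf\<close>, its product being \<^const>\<open>inf\<close>;
  the monoid \<open>T\<close> is a type of class \<^class>\<open>monoid_mult\<close>. A graph is given by its edge set.
\<close>

type_synonym ('e, 't) edge = "'e \<times> 't \<times> 'e"

abbreviation edge_src :: "('e, 't) edge \<Rightarrow> 'e" where "edge_src c \<equiv> fst c"
abbreviation edge_lab :: "('e, 't) edge \<Rightarrow> 't" where "edge_lab c \<equiv> fst (snd c)"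
abbreviation edge_tgt :: "('e, 't) edge \<Rightarrow> 'e" where "edge_tgt c \<equiv> snd (snd c)"

definition paths :: "('e, 't) edge set \<Rightarrow> ('e, 't) edge list set" where
  "paths G = {p. p \<noteq> [] \<and> set p \<subseteq> G \<and> successively (\<lambda>a b. edge_tgt a = edge_src b) p}"

definition path_src :: "('e, 't) edge list \<Rightarrow> 'e" where
  "path_src p = edge_src (hd p)"

definition path_tgt :: "('e, 't) edge list \<Rightarrow> 'e" where
  "path_tgt p = edge_tgt (last p)"

definition path_lab :: "('e, 't::monoid_mult) edge list \<Rightarrow> 't" where
  "path_lab p = prod_list (map edge_lab p)"

text \<open>The triple which, if it is an edge, is parallel to \<open>p\<close> with the same label.\<close>

definition path_edge :: "('e, 't::monoid_mult) edge list \<Rightarrow> ('e, 't) edge" where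
  "path_edge p = (path_src p, path_lab p, path_tgt p)"

text \<open>
  \<open>res g c\<close> is the restriction ${}_g|c$, relevant only for \<open>g \<le> edge_src c\<close>, and \<open>cor c g\<close>
  is the corestriction $c|_g$, relevant only for \<open>g \<le> edge_tgt c\<close>. Both are extended to paths.
\<close>

fun path_res :: "('e \<Rightarrow> ('e, 't) edge \<Rightarrow> ('e, 't) edge) \<Rightarrow> 'e \<Rightarrow> ('e, 't) edge list
    \<Rightarrow> ('e, 't) edge list" where
  "path_res res g [] = []"
| "path_res res g (c # p) = res g c # path_res res (edge_tgt (res g c)) p"

fun path_cor :: "(('e, 't) edge \<Rightarrow> 'e \<Rightarrow> ('e, 't) edge) \<Rightarrow> ('e, 't) edge list \<Rightarrow> 'e
    \<Rightarrow> ('e, 't) edge list" where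
  "path_cor cor [] g = []"
| "path_cor cor [c] g = [cor c g]"
| "path_cor cor (c # c' # p) g =
     (let q = path_cor cor (c' # p) g in cor c (path_src q) # q)"

locale labelled_graph =
  fixes G :: "('e::semilattice_inf, 't::monoid_mult) edge set"
  assumes loops: "(e, 1, e) \<in> G"
    and labels: "\<exists>p\<in>paths G. path_lab p = t"

locale labelled_graph_restrictions = labelled_graph G
  for G :: "('e::semilattice_inf, 't::monoid_mult) edge set" +
  fixes res :: "'e \<Rightarrow> ('e, 't) edge \<Rightarrow> ('e, 't) edge"
  assumes R1: "(e, t, f) \<in> G \<Longrightarrow> g \<le> e \<Longrightarrow> \<exists>f'\<le>f. (g, t, f') \<in> G \<and> res g (e, t, f) = (g, t, f')"
    and R2: "(e, t, f) \<in> G \<Longrightarrow> res e (e, t, f) = (e, t, f)"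
    and R3: "(e, t, f) \<in> G \<Longrightarrow> h \<le> g \<Longrightarrow> g \<le> e \<Longrightarrow> res h (res g (e, t, f)) = res h (e, t, f)"
    and R4: "p \<in> paths G \<Longrightarrow> length p \<ge> 2 \<Longrightarrow> path_edge p \<in> G \<Longrightarrow> g \<le> path_src p \<Longrightarrow>
          res g (path_edge p) = (g, path_lab p, path_tgt (path_res res g p))"
    and R5: "f \<le> e \<Longrightarrow> res f (e, 1, e) = (f, 1, f)"

locale labelled_graph_corestrictions = labelled_graph G
  for G :: "('e::semilattice_inf, 't::monoid_mult) edge set" +
  fixes cor :: "('e, 't) edge \<Rightarrow> 'e \<Rightarrow> ('e, 't) edge"
  assumes CR1: "(e, t, f) \<in> G \<Longrightarrow> g \<le> f \<Longrightarrow> \<exists>e'\<le>e. (e', t, g) \<in> G \<and> cor (e, t, f) g = (e', t, g)"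
    and CR2: "(e, t, f) \<in> G \<Longrightarrow> cor (e, t, f) f = (e, t, f)"
    and CR3: "(e, t, f) \<in> G \<Longrightarrow> h \<le> g \<Longrightarrow> g \<le> f \<Longrightarrow> cor (cor (e, t, f) g) h = cor (e, t, f) h"
    and CR4: "p \<in> paths G \<Longrightarrow> length p \<ge> 2 \<Longrightarrow> path_edge p \<in> G \<Longrightarrow> g \<le> path_tgt p \<Longrightarrow>
          cor (path_edge p) g = (path_src (path_cor cor p g), path_lab p, g)"
    and CR5: "f \<le> e \<Longrightarrow> cor (e, 1, e) f = (f, 1, f)"

locale compatible_labelled_graph =
  labelled_graph_restrictions G res + labelled_graph_corestrictions G cor
  for G :: "('e::semilattice_inf, 't::monoid_mult) edge set"
    and res :: "'e \<Rightarrow> ('e, 't) edge \<Rightarrow> ('e, 't) edge"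
    and cor :: "('e, 't) edge \<Rightarrow> 'e \<Rightarrow> ('e, 't) edge" +
  assumes compat_left: "c = (e, t, f) \<Longrightarrow> c \<in> G \<Longrightarrow> g \<le> e \<Longrightarrow> h \<le> f \<Longrightarrow>
          cor (res g c) (inf (edge_tgt (res g c)) h) =
            (inf g (edge_src (cor c h)), t, inf (edge_tgt (res g c)) h)"
    and compat_right: "c = (e, t, f) \<Longrightarrow> c \<in> G \<Longrightarrow> g \<le> e \<Longrightarrow> h \<le> f \<Longrightarrow>
          res (inf (edge_src (cor c h)) g) (cor c h) =
            (inf g (edge_src (cor c h)), t, inf (edge_tgt (res g c)) h)"


section \<open>The algebra constructed from a graph\<close>

inductive_set path_cong :: "('e, 't::monoid_mult) edge set
    \<Rightarrow> (('e, 't) edge list \<times> ('e, 't) edge list) set"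
  for G :: "('e, 't) edge set" where
  gen: "p \<in> paths G \<Longrightarrow> length p \<ge> 2 \<Longrightarrow> path_edge p \<in> G \<Longrightarrow> (p, [path_edge p]) \<in> path_cong G"
| refl: "p \<in> paths G \<Longrightarrow> (p, p) \<in> path_cong G"
| sym: "(p, q) \<in> path_cong G \<Longrightarrow> (q, p) \<in> path_cong G"
| trans: "(p, q) \<in> path_cong G \<Longrightarrow> (q, r) \<in> path_cong G \<Longrightarrow> (p, r) \<in> path_cong G"
| comp: "(p, p') \<in> path_cong G \<Longrightarrow> (q, q') \<in> path_cong G \<Longrightarrow> path_tgt p = path_src q \<Longrightarrow>
    (p @ q, p' @ q') \<in> path_cong G"

definition arrows :: "('e, 't::monoid_mult) edge set \<Rightarrow> ('e, 't) edge list set set" where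
  "arrows G = paths G // path_cong G"

definition arrow_of :: "('e, 't::monoid_mult) edge set \<Rightarrow> ('e, 't) edge list
    \<Rightarrow> ('e, 't) edge list set" where
  "arrow_of G p = path_cong G `` {p}"

text \<open>
  Functions of paths that are constant on congruence classes are passed to classes by
  \<^const>\<open>the_elem\<close>, and operations with values in classes by taking the union over all
  representatives.
\<close>

definition arrow_src :: "('e, 't) edge list set \<Rightarrow> 'e" where
  "arrow_src c = the_elem (path_src ` c)"

definition arrow_tgt :: "('e, 't) edge list set \<Rightarrow> 'e" where
  "arrow_tgt c = the_elem (path_tgt ` c)"

definition arrow_lab :: "('e, 't::monoid_mult) edge list set \<Rightarrow> 't" where
  "arrow_lab c = the_elem (path_lab ` c)"

definition arrow_comp :: "('e, 't::monoid_mult) edge set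
    \<Rightarrow> ('e, 't) edge list set \<Rightarrow> ('e, 't) edge list set \<Rightarrow> ('e, 't) edge list set" where
  "arrow_comp G c d = (\<Union>p\<in>c. \<Union>q\<in>d. arrow_of G (p @ q))"

definition arrow_res :: "('e, 't::monoid_mult) edge set
    \<Rightarrow> ('e \<Rightarrow> ('e, 't) edge \<Rightarrow> ('e, 't) edge)
    \<Rightarrow> 'e \<Rightarrow> ('e, 't) edge list set \<Rightarrow> ('e, 't) edge list set" where
  "arrow_res G res g c = (\<Union>p\<in>c. arrow_of G (path_res res g p))"

definition arrow_cor :: "('e, 't::monoid_mult) edge set
    \<Rightarrow> (('e, 't) edge \<Rightarrow> 'e \<Rightarrow> ('e, 't) edge)
    \<Rightarrow> ('e, 't) edge list set \<Rightarrow> 'e \<Rightarrow> ('e, 't) edge list set" where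
  "arrow_cor G cor c g = (\<Union>p\<in>c. arrow_of G (path_cor cor p g))"

definition graph_product :: "('e::semilattice_inf, 't::monoid_mult) edge set
    \<Rightarrow> ('e \<Rightarrow> ('e, 't) edge \<Rightarrow> ('e, 't) edge)
    \<Rightarrow> (('e, 't) edge \<Rightarrow> 'e \<Rightarrow> ('e, 't) edge)
    \<Rightarrow> ('e, 't) edge list set biunary" where
  "graph_product G res cor =
     \<lparr>carrier = arrows G,
      bmult = (\<lambda>c d. arrow_comp G
        (arrow_cor G cor c (inf (arrow_tgt c) (arrow_src d)))
        (arrow_res G res (inf (arrow_tgt c) (arrow_src d)) d)),
      lproj = (\<lambda>c. arrow_of G [(arrow_src c, 1, arrow_src c)]),
      rproj = (\<lambda>c. arrow_of G [(arrow_tgt c, 1, arrow_tgt c)])\<rparr>"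

definition monoid_of_class :: "'t::monoid_mult monoid" where
  "monoid_of_class = \<lparr>carrier = UNIV, mult = (*), one = 1\<rparr>"

end

theory Submission
  imports Defs
begin

text \<open>
  The product of two arrows is computed on representing paths: with \<open>m\<close> the meet of the target of
  \<open>p\<close> and the source of \<open>q\<close>, corestrict \<open>p\<close> to \<open>m\<close>, restrict \<open>q\<close> to \<open>m\<close> and concatenate. Everything
  rests on two facts about this product. First, it is strictly associative on paths
  (\<open>path_mult_assoc\<close>). Both bracketings of a triple product cut the middle path down from its two ends,
  in opposite orders, and the compatibility axiom, extended from edges to paths (\<open>path_compatible\<close>),
  says that the order does not matter. Second, it respects the path congruence (\<open>path_cong_mult\<close>),
  because the axioms on edges parallel to a path say that restricting a generating pair gives a
  generating pair.

  On classes, multiplying by the loop \<open>(e, 1, e)\<close> is restriction or corestriction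
  (\<open>unit_arrow_mult\<close>, \<open>mult_unit_arrow\<close>), since a loop at an end of a path is absorbed by the
  neighbouring edge. The remaining Ehresmann axioms, the description of the projections and the
  description of the three orders are read off from this. The label is a homomorphism to \<open>T\<close> that maps
  all projections to \<open>1\<close>, so \<open>\<sigma>\<close> is contained in its kernel; when the two agree, the label induces an
  isomorphism from the quotient by \<open>\<sigma>\<close> to \<open>T\<close>.

  An edge is determined by its source, target and label, hence is a proper element. Matching
  factorizations of an arrow into edges are the same thing as paths representing it
  (\<open>edge_factorizations\<close>), so existence of a factorization is clear, and two of them are congruent
  paths. The path congruence is generated by contracting segments to parallel edges, and each such
  contraction is a step between factorizations (\<open>path_cong_equivalent_factorizations\<close>).
\<close>


section \<open>The quotient of an Ehresmann semigroup by \<open>\<sigma>\<close>\<close>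

lemma sigma_least:
  "congruence S \<rho> \<Longrightarrow> projections S \<times> projections S \<subseteq> \<rho> \<Longrightarrow> sigma S \<subseteq> \<rho>"
  by (auto simp: sigma_def)

lemma projections_sigma:
  "a \<in> projections S \<Longrightarrow> b \<in> projections S \<Longrightarrow> (a, b) \<in> sigma S"
  by (auto simp: sigma_def)

context ehresmann_semigroup
begin

lemma projections_subset_carrier: "projections S \<subseteq> carrier S"
  by (auto simp: projections_def lproj_closed)

lemma sigma_subset_carrier: "sigma S \<subseteq> carrier S \<times> carrier S"
proof (rule sigma_least)
  show "congruence S (carrier S \<times> carrier S)"
    unfolding congruence_def
    by (auto intro!: equivI refl_onI symI transI simp: bmult_closed lproj_closed rproj_closed)
qed (use projections_subset_carrier in blast)

lemma sigma_congruence: "congruence S (sigma S)"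
proof -
  have "refl_on (carrier S) (sigma S)"
    by (rule refl_onI) (auto simp: sigma_def congruence_def equiv_def dest: refl_onD)
  moreover have "sym (sigma S)"
    by (rule symI) (auto simp: sigma_def congruence_def equiv_def dest: symD)
  moreover have "trans (sigma S)"
  proof (rule transI)
    fix a b c assume ab: "(a, b) \<in> sigma S" and bc: "(b, c) \<in> sigma S"
    have "(a, c) \<in> \<rho>" if "congruence S \<rho>" "projections S \<times> projections S \<subseteq> \<rho>" for \<rho>
    proof -
      have "trans \<rho>"
        using that(1) by (simp add: congruence_def equiv_def)
      then show ?thesis
        using sigma_least[OF that] ab bc by (blast dest: transD)
    qed
    then show "(a, c) \<in> sigma S"
      by (simp add: sigma_def)
  qed
  ultimately have "equiv (carrier S) (sigma S)"
    using sigma_subset_carrier by (simp add: equiv_def)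
  then show ?thesis
    unfolding congruence_def by (auto simp: sigma_def congruence_def)
qed

lemma sigma_equiv: "equiv (carrier S) (sigma S)"
  using sigma_congruence by (simp add: congruence_def)

lemma sigma_quotient_mult:
  assumes "a \<in> carrier S" "b \<in> carrier S"
  shows "mult (sigma_quotient S) (sigma S `` {a}) (sigma S `` {b}) = sigma S `` {a \<odot> b}"
proof -
  have "congruent2 (sigma S) (sigma S) (\<lambda>x y. sigma S `` {x \<odot> y})"
    using sigma_congruence equiv_class_eq[OF sigma_equiv]
    unfolding congruent2_def congruence_def by blast
  then show ?thesis
    using UN_equiv_class2[OF sigma_equiv sigma_equiv] assms by (simp add: sigma_quotient_def)
qed

lemma sigma_quotient_one:
  assumes "e \<in> projections S"
  shows "one (sigma_quotient S) = sigma S `` {e}"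
proof -
  have "sigma S `` {f} = sigma S `` {e}" if "f \<in> projections S" for f
    using equiv_class_eq[OF sigma_equiv] projections_sigma[OF that assms] by simp
  then have "(\<Union>f\<in>projections S. sigma S `` {f}) = sigma S `` {e}"
    using assms by blast
  then show ?thesis
    by (simp add: sigma_quotient_def flip: Image_eq_UN)
qed

lemma lproj_in_projections: "a \<in> carrier S \<Longrightarrow> lproj S a \<in> projections S"
  by (auto simp: projections_def)

lemma rproj_in_projections: "a \<in> carrier S \<Longrightarrow> rproj S a \<in> projections S"
  by (metis imageI lproj_of_rproj projections_def rproj_closed)

lemma carrier_sigma_quotient:
  "carrier (sigma_quotient S) = (\<lambda>a. sigma S `` {a}) ` carrier S"
  by (auto simp: sigma_quotient_def quotient_def)

text \<open>
  Both \<open>x\<^sup>+ x = x\<close> and \<open>x x\<^sup>* = x\<close> become identity laws modulo \<open>\<sigma>\<close>, because all projections fall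
  into one class.
\<close>

lemma sigma_quotient_monoid:
  assumes "carrier S \<noteq> {}"
  shows "monoid (sigma_quotient S)"
proof (rule monoidI)
  obtain x where x: "x \<in> carrier S"
    using assms by blast
  show "one (sigma_quotient S) \<in> carrier (sigma_quotient S)"
    using sigma_quotient_one[OF lproj_in_projections[OF x]] lproj_closed[OF x]
    by (auto simp: carrier_sigma_quotient)
next
  fix X assume "X \<in> carrier (sigma_quotient S)"
  then obtain a where a: "a \<in> carrier S" and X: "X = sigma S `` {a}"
    by (auto simp: carrier_sigma_quotient)
  show "mult (sigma_quotient S) (one (sigma_quotient S)) X = X"
    using sigma_quotient_one[OF lproj_in_projections[OF a]]
    by (simp add: X sigma_quotient_mult a lproj_closed lproj_bmult)
  show "mult (sigma_quotient S) X (one (sigma_quotient S)) = X"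
    using sigma_quotient_one[OF rproj_in_projections[OF a]]
    by (simp add: X sigma_quotient_mult a rproj_closed bmult_rproj)
qed (auto simp: carrier_sigma_quotient sigma_quotient_mult bmult_closed bmult_assoc)

lemma sigma_quotient_iso:
  assumes M: "monoid M"
    and surj: "f ` carrier S = carrier M"
    and hom: "\<And>a b. a \<in> carrier S \<Longrightarrow> b \<in> carrier S \<Longrightarrow> f (a \<odot> b) = mult M (f a) (f b)"
    and kernel: "\<And>a b. a \<in> carrier S \<Longrightarrow> b \<in> carrier S \<Longrightarrow> (a, b) \<in> sigma S \<longleftrightarrow> f a = f b"
  shows "sigma_quotient S \<cong> M"
proof -
  define \<phi> where "\<phi> X = the_elem (f ` X)" for X
  have \<phi>: "\<phi> (sigma S `` {a}) = f a" if "a \<in> carrier S" for a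
  proof -
    have "f ` (sigma S `` {a}) = {f a}"
      using that kernel sigma_subset_carrier by fastforce
    then show ?thesis
      by (simp add: \<phi>_def)
  qed
  have "\<phi> \<in> hom (sigma_quotient S) M"
    using surj by (auto simp: hom_def carrier_sigma_quotient \<phi> sigma_quotient_mult bmult_closed hom)
  moreover have "inj_on \<phi> (carrier (sigma_quotient S))"
    by (auto simp: inj_on_def carrier_sigma_quotient \<phi> kernel[symmetric]
        equiv_class_eq[OF sigma_equiv])
  moreover have "\<phi> ` carrier (sigma_quotient S) = carrier M"
    using surj by (simp add: carrier_sigma_quotient image_image \<phi> cong: image_cong_simp)
  ultimately show ?thesis
    by (auto simp: is_iso_def iso_def bij_betw_def)
qed

end


section \<open>Paths, their restrictions and corestrictions\<close>

lemma paths_nonempty: "p \<in> paths G \<Longrightarrow> p \<noteq> []"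
  by (simp add: paths_def)

lemma paths_Cons:
  "c # p \<in> paths G \<longleftrightarrow> c \<in> G \<and> (p = [] \<or> p \<in> paths G \<and> edge_tgt c = path_src p)"
  by (auto simp: paths_def successively_Cons path_src_def)

lemma paths_singleton [simp]: "[c] \<in> paths G \<longleftrightarrow> c \<in> G"
  by (auto simp: paths_Cons)

lemma paths_append:
  "p \<noteq> [] \<Longrightarrow> q \<noteq> [] \<Longrightarrow>
   p @ q \<in> paths G \<longleftrightarrow> p \<in> paths G \<and> q \<in> paths G \<and> path_tgt p = path_src q"
  by (auto simp: paths_def successively_append_iff path_src_def path_tgt_def)

lemma path_src_Cons [simp]: "path_src (c # p) = edge_src c"
  by (simp add: path_src_def)

lemma path_tgt_Cons [simp]: "path_tgt (c # p) = (if p = [] then edge_tgt c else path_tgt p)"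
  by (simp add: path_tgt_def)

lemma path_lab_simps [simp]: "path_lab [] = 1" "path_lab (c # p) = edge_lab c * path_lab p"
  by (simp_all add: path_lab_def)

lemma path_src_append [simp]: "p \<noteq> [] \<Longrightarrow> path_src (p @ q) = path_src p"
  by (simp add: path_src_def)

lemma path_tgt_append [simp]: "q \<noteq> [] \<Longrightarrow> path_tgt (p @ q) = path_tgt q"
  by (simp add: path_tgt_def)

lemma path_lab_append [simp]: "path_lab (p @ q) = path_lab p * path_lab q"
  by (simp add: path_lab_def)

lemma path_edge_simps [simp]:
  "path_edge [c] = c"
  "edge_src (path_edge p) = path_src p"
  "edge_lab (path_edge p) = path_lab p"
  "edge_tgt (path_edge p) = path_tgt p"
  by (simp_all add: path_edge_def)

lemma paths_induct [consumes 1, case_names singleton Cons]: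
  assumes "p \<in> paths G"
    and "\<And>c. c \<in> G \<Longrightarrow> P [c]"
    and "\<And>c p. c \<in> G \<Longrightarrow> p \<in> paths G \<Longrightarrow> edge_tgt c = path_src p \<Longrightarrow> P p \<Longrightarrow> P (c # p)"
  shows "P p"
  using assms(1)
proof (induction p)
  case Nil
  then show ?case by (simp add: paths_def)
next
  case (Cons c p)
  then show ?case
    using assms(2,3) by (cases "p = []") (auto simp: paths_Cons)
qed

lemma path_res_eq_Nil [simp]: "path_res res g p = [] \<longleftrightarrow> p = []"
  by (cases p) auto

lemma path_cor_Cons:
  "p \<noteq> [] \<Longrightarrow>
   path_cor cor (c # p) g = cor c (path_src (path_cor cor p g)) # path_cor cor p g"
  by (cases p) (auto simp: Let_def)

lemma path_cor_eq_Nil [simp]: "path_cor cor p g = [] \<longleftrightarrow> p = []"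
  by (induction cor p g rule: path_cor.induct) (auto simp: Let_def)

lemma path_res_append:
  "p \<noteq> [] \<Longrightarrow>
   path_res res g (p @ q) = path_res res g p @ path_res res (path_tgt (path_res res g p)) q"
  by (induction p arbitrary: g) (auto split: if_splits)

lemma path_cor_append:
  "q \<noteq> [] \<Longrightarrow>
   path_cor cor (p @ q) g = path_cor cor p (path_src (path_cor cor q g)) @ path_cor cor q g"
proof (induction p)
  case (Cons c p)
  then show ?case by (cases "p = []") (simp_all add: path_cor_Cons)
qed simp

context labelled_graph_restrictions
begin

lemma res_edge:
  assumes "c \<in> G" "g \<le> edge_src c"
  shows "res g c \<in> G" "edge_src (res g c) = g" "edge_lab (res g c) = edge_lab c"
    "edge_tgt (res g c) \<le> edge_tgt c"
  using assms R1[of "edge_src c" "edge_lab c" "edge_tgt c" g] by auto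

lemma res_res: "c \<in> G \<Longrightarrow> h \<le> g \<Longrightarrow> g \<le> edge_src c \<Longrightarrow> res h (res g c) = res h c"
  using R3[of "edge_src c" "edge_lab c" "edge_tgt c" h g] by simp

lemma path_res_path:
  assumes "p \<in> paths G" "g \<le> path_src p"
  shows "path_res res g p \<in> paths G \<and> path_src (path_res res g p) = g \<and>
    path_lab (path_res res g p) = path_lab p \<and> path_tgt (path_res res g p) \<le> path_tgt p"
  using assms
proof (induction arbitrary: g rule: paths_induct)
  case (singleton c)
  then show ?case by (simp add: res_edge)
next
  case (Cons c p)
  then have "edge_tgt (res g c) \<le> path_src p"
    using res_edge(4)[of c g] by simp
  then show ?case
    using Cons by (auto simp: paths_Cons res_edge dest: paths_nonempty)
qed

lemmas path_res_in_paths = path_res_path[THEN conjunct1]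
  and path_src_res = path_res_path[THEN conjunct2, THEN conjunct1]
  and path_tgt_res_le = path_res_path[THEN conjunct2, THEN conjunct2, THEN conjunct2]

lemma path_res_src: "p \<in> paths G \<Longrightarrow> path_res res (path_src p) p = p"
  by (induction rule: paths_induct) (use R2 in \<open>auto\<close>)

lemma path_res_res:
  assumes "p \<in> paths G" "g \<le> path_src p" "h \<le> g"
  shows "path_res res h (path_res res g p) = path_res res h p"
  using assms
proof (induction arbitrary: g h rule: paths_induct)
  case (singleton c)
  then show ?case
    by (simp add: res_res)
next
  case (Cons c p)
  have eq: "res h (res g c) = res h c"
    using Cons.hyps Cons.prems by (simp add: res_res)
  have "edge_tgt (res h c) \<le> edge_tgt (res g c)"
    using res_edge(4)[of "res g c" h] res_edge(1,2)[of c g] Cons.hyps Cons.prems eq by simp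
  moreover have "edge_tgt (res g c) \<le> path_src p"
    using res_edge(4)[of c g] Cons.hyps Cons.prems by simp
  ultimately show ?case
    using Cons.IH eq by simp
qed

end

context labelled_graph_corestrictions
begin

lemma cor_edge:
  assumes "c \<in> G" "g \<le> edge_tgt c"
  shows "cor c g \<in> G" "edge_tgt (cor c g) = g" "edge_lab (cor c g) = edge_lab c"
    "edge_src (cor c g) \<le> edge_src c"
  using assms CR1[of "edge_src c" "edge_lab c" "edge_tgt c" g] by auto

lemma cor_cor: "c \<in> G \<Longrightarrow> h \<le> g \<Longrightarrow> g \<le> edge_tgt c \<Longrightarrow> cor (cor c g) h = cor c h"
  using CR3[of "edge_src c" "edge_lab c" "edge_tgt c" h g] by simp

lemma path_cor_path:
  assumes "p \<in> paths G" "g \<le> path_tgt p"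
  shows "path_cor cor p g \<in> paths G \<and> path_tgt (path_cor cor p g) = g \<and>
    path_lab (path_cor cor p g) = path_lab p \<and> path_src (path_cor cor p g) \<le> path_src p"
  using assms
proof (induction rule: paths_induct)
  case (singleton c)
  then show ?case by (simp add: cor_edge)
next
  case (Cons c p)
  then show ?case
    using paths_nonempty[of p G] by (auto simp: paths_Cons path_cor_Cons cor_edge)
qed

lemmas path_cor_in_paths = path_cor_path[THEN conjunct1]
  and path_tgt_cor = path_cor_path[THEN conjunct2, THEN conjunct1]
  and path_src_cor_le = path_cor_path[THEN conjunct2, THEN conjunct2, THEN conjunct2]

lemma path_cor_tgt: "p \<in> paths G \<Longrightarrow> path_cor cor p (path_tgt p) = p"
proof (induction rule: paths_induct)
  case (singleton c)
  then show ?case using CR2[of "edge_src c" "edge_lab c" "edge_tgt c"] by simp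
next
  case (Cons c p)
  then show ?case
    using CR2[of "edge_src c" "edge_lab c" "edge_tgt c"] paths_nonempty[of p G]
    by (simp add: path_cor_Cons flip: Cons.hyps(3))
qed

lemma path_cor_cor:
  assumes "p \<in> paths G" "g \<le> path_tgt p" "h \<le> g"
  shows "path_cor cor (path_cor cor p g) h = path_cor cor p h"
  using assms
proof (induction rule: paths_induct)
  case (singleton c)
  then show ?case
    by (simp add: cor_cor)
next
  case (Cons c p)
  have ne: "p \<noteq> []"
    using Cons.hyps paths_nonempty by blast
  have g: "g \<le> path_tgt p"
    using Cons.prems ne by simp
  have IH: "path_cor cor (path_cor cor p g) h = path_cor cor p h"
    using Cons.IH g Cons.prems by simp
  have "path_src (path_cor cor p h) \<le> path_src (path_cor cor p g)"
    using path_src_cor_le[of "path_cor cor p g" h] path_cor_path[OF Cons.hyps(2) g] Cons.prems IH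
    by simp
  moreover have "path_src (path_cor cor p g) \<le> edge_tgt c"
    using path_src_cor_le[OF Cons.hyps(2) g] Cons.hyps by simp
  ultimately show ?case
    using Cons.hyps(1) ne IH by (simp add: path_cor_Cons cor_cor)
qed

end

context compatible_labelled_graph
begin

lemma edge_compatible:
  assumes "c \<in> G" "g \<le> edge_src c" "h \<le> edge_tgt c"
  shows "cor (res g c) (inf (edge_tgt (res g c)) h) =
      (inf g (edge_src (cor c h)), edge_lab c, inf (edge_tgt (res g c)) h)"
    "res (inf g (edge_src (cor c h))) (cor c h) =
      (inf g (edge_src (cor c h)), edge_lab c, inf (edge_tgt (res g c)) h)"
  using assms compat_left[of c "edge_src c" "edge_lab c" "edge_tgt c" g h]
    compat_right[of c "edge_src c" "edge_lab c" "edge_tgt c" g h]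
  by (simp_all add: inf_commute)

text \<open>
  Compatibility extends from edges to paths, as an equality of paths and not merely of their
  classes. For a path \<open>c # p\<close> the axiom for \<open>c\<close> is used with the source of the corestriction of
  \<open>p\<close>, so that the vertex where the two halves meet is the same on both sides.
\<close>

lemma path_compatible:
  assumes "p \<in> paths G" "g \<le> path_src p" "h \<le> path_tgt p"
  shows "path_cor cor (path_res res g p) (inf (path_tgt (path_res res g p)) h) =
      path_res res (inf (path_src (path_cor cor p h)) g) (path_cor cor p h) \<and>
    path_src (path_cor cor (path_res res g p) (inf (path_tgt (path_res res g p)) h)) =
      inf (path_src (path_cor cor p h)) g \<and>
    path_tgt (path_cor cor (path_res res g p) (inf (path_tgt (path_res res g p)) h)) =
      inf (path_tgt (path_res res g p)) h"
  using assms
proof (induction arbitrary: g rule: paths_induct)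
  case (singleton c)
  then show ?case
    using edge_compatible[of c g h] by (simp add: inf_commute)
next
  case (Cons c p)
  define g1 where "g1 = edge_tgt (res g c)"
  define k where "k = path_src (path_cor cor p h)"
  have ne: "p \<noteq> []"
    using Cons.hyps paths_nonempty by blast
  have g1: "g1 \<le> path_src p"
    using res_edge(4)[of c g] Cons.hyps Cons.prems by (simp add: g1_def)
  have h: "h \<le> path_tgt p"
    using Cons.prems ne by simp
  have k: "k \<le> edge_tgt c"
    using path_src_cor_le[OF Cons.hyps(2) h] Cons.hyps by (simp add: k_def)
  have g: "g \<le> edge_src c"
    using Cons.prems by simp
  note IH = Cons.IH[OF g1 h, folded k_def]
  note IH1 = IH[THEN conjunct1] and IH2 = IH[THEN conjunct2]
  have tgt: "path_tgt (path_res res g (c # p)) = path_tgt (path_res res g1 p)"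
    using ne by (simp add: g1_def)
  have "path_cor cor (path_res res g (c # p)) (inf (path_tgt (path_res res g1 p)) h) =
      cor (res g c) (inf g1 k) #
      path_cor cor (path_res res g1 p) (inf (path_tgt (path_res res g1 p)) h)"
    using ne IH2 by (simp add: path_cor_Cons inf_commute flip: g1_def)
  also have "cor (res g c) (inf g1 k) = (inf g (edge_src (cor c k)), edge_lab c, inf g1 k)"
    using edge_compatible(1)[OF Cons.hyps(1) g k] by (simp add: g1_def)
  finally have left: "path_cor cor (path_res res g (c # p)) (inf (path_tgt (path_res res g1 p)) h) =
      (inf g (edge_src (cor c k)), edge_lab c, inf g1 k) #
      path_cor cor (path_res res g1 p) (inf (path_tgt (path_res res g1 p)) h)" .
  have "path_res res (inf (edge_src (cor c k)) g) (path_cor cor (c # p) h) =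
      (inf g (edge_src (cor c k)), edge_lab c, inf g1 k) #
      path_res res (inf g1 k) (path_cor cor p h)"
    using edge_compatible(2)[OF Cons.hyps(1) g k] ne
    by (simp add: path_cor_Cons inf_commute flip: g1_def k_def)
  moreover have "path_src (path_cor cor (c # p) h) = edge_src (cor c k)"
    using ne by (simp add: path_cor_Cons k_def)
  ultimately show ?case
    unfolding tgt left using IH1 IH2 ne by (simp add: inf_commute)
qed

lemmas path_cor_res = path_compatible[THEN conjunct1]
  and path_src_cor_res = path_compatible[THEN conjunct2, THEN conjunct1]
  and path_tgt_cor_res = path_compatible[THEN conjunct2, THEN conjunct2]


section \<open>The product of paths\<close>

text \<open>
  The product of the semigroup of arrows, computed on representatives. It is associative on paths already, before
  passing to classes, whereas a loop \<open>(e, 1, e)\<close> is neutral for the paths that start or end at \<open>e\<close>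
  only up to congruence.
\<close>

definition path_mult :: "('e, 't) edge list \<Rightarrow> ('e, 't) edge list \<Rightarrow> ('e, 't) edge list"
  (infixl "\<star>" 70) where
  "p \<star> q = path_cor cor p (inf (path_tgt p) (path_src q)) @
           path_res res (inf (path_tgt p) (path_src q)) q"

lemma path_mult_path:
  assumes "p \<in> paths G" "q \<in> paths G"
  shows "p \<star> q \<in> paths G \<and>
    path_src (p \<star> q) = path_src (path_cor cor p (inf (path_tgt p) (path_src q))) \<and>
    path_tgt (p \<star> q) = path_tgt (path_res res (inf (path_tgt p) (path_src q)) q) \<and>
    path_lab (p \<star> q) = path_lab p * path_lab q"
  using assms path_cor_path[OF assms(1), of "inf (path_tgt p) (path_src q)"]
    path_res_path[OF assms(2), of "inf (path_tgt p) (path_src q)"]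
    paths_nonempty[OF assms(1)] paths_nonempty[OF assms(2)]
  by (simp add: path_mult_def paths_append)

lemmas path_mult_in_paths = path_mult_path[THEN conjunct1]
  and path_src_mult = path_mult_path[THEN conjunct2, THEN conjunct1]
  and path_tgt_mult = path_mult_path[THEN conjunct2, THEN conjunct2, THEN conjunct1]
  and path_lab_mult = path_mult_path[THEN conjunct2, THEN conjunct2, THEN conjunct2]

text \<open>
  Either way of bracketing \<open>p\<close>, \<open>q\<close>, \<open>r\<close> cuts \<open>q\<close> down from both sides, to \<open>m\<close> at the source and to
  \<open>n\<close> at the target, once restricting first and once corestricting first. By compatibility the
  middle factor is the same, and its source and target determine the two outer factors.
\<close>

lemma path_mult_assoc:
  assumes p: "p \<in> paths G" and q: "q \<in> paths G" and r: "r \<in> paths G"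
  shows "(p \<star> q) \<star> r = p \<star> (q \<star> r)"
proof -
  define m where "m = inf (path_tgt p) (path_src q)"
  define n where "n = inf (path_tgt q) (path_src r)"
  define m' where "m' = inf (path_tgt p) (path_src (path_cor cor q n))"
  define n' where "n' = inf (path_tgt (path_res res m q)) (path_src r)"
  have m: "m \<le> path_tgt p" "m \<le> path_src q" and n: "n \<le> path_tgt q" "n \<le> path_src r"
    by (simp_all add: m_def n_def)
  have mm: "inf (path_src (path_cor cor q n)) m = m'"
    using path_src_cor_le[OF q n(1)] unfolding m'_def m_def
    by (metis inf.absorb1 inf.commute inf.left_commute)
  have nn: "inf (path_tgt (path_res res m q)) n = n'"
    using path_tgt_res_le[OF q m(2)] unfolding n'_def n_def
    by (metis inf.absorb1 inf.assoc)
  have le: "m' \<le> m" "n' \<le> n"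
    using mm nn by (metis inf_le2)+
  note middle = path_cor_res[OF q m(2) n(1), unfolded mm nn]
    path_src_cor_res[OF q m(2) n(1), unfolded mm nn]
    path_tgt_cor_res[OF q m(2) n(1), unfolded mm nn]
  have ne: "p \<noteq> []" "q \<noteq> []" "r \<noteq> []"
    using p q r paths_nonempty by blast+
  have "(p \<star> q) \<star> r = path_cor cor (p \<star> q) n' @ path_res res n' r"
    using path_tgt_mult[OF p q] by (simp add: path_mult_def[of "p \<star> q" r] n'_def m_def)
  also have "path_cor cor (p \<star> q) n' = path_cor cor p m' @ path_cor cor (path_res res m q) n'"
    using ne middle(2) path_cor_cor[OF p m(1) le(1)]
    by (simp add: path_mult_def path_cor_append flip: m_def)
  finally have left: "(p \<star> q) \<star> r =
      path_cor cor p m' @ path_cor cor (path_res res m q) n' @ path_res res n' r"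
    by simp
  have "p \<star> (q \<star> r) = path_cor cor p m' @ path_res res m' (q \<star> r)"
    using path_src_mult[OF q r] by (simp add: path_mult_def[of p "q \<star> r"] m'_def n_def)
  also have "path_res res m' (q \<star> r) = path_res res m' (path_cor cor q n) @ path_res res n' r"
    using ne middle(1,3) path_res_res[OF r n(2) le(2)]
    by (simp add: path_mult_def path_res_append flip: n_def)
  finally show ?thesis
    using left middle(1) by simp
qed

end

section \<open>Congruent paths\<close>

lemma path_cong_invariants:
  assumes "(p, q) \<in> path_cong G"
  shows "p \<in> paths G \<and> q \<in> paths G \<and> path_src p = path_src q \<and> path_tgt p = path_tgt q \<and>
    path_lab p = path_lab q"
  using assms
proof induction
  case (comp p p' q q')
  then have "p \<noteq> []" "p' \<noteq> []" "q \<noteq> []" "q' \<noteq> []"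
    using paths_nonempty by blast+
  with comp show ?case
    by (simp add: paths_append)
qed auto

lemma path_cong_equiv: "equiv (paths G) (path_cong G)"
proof (rule equivI)
  show "path_cong G \<subseteq> paths G \<times> paths G"
    by (auto dest: path_cong_invariants)
  show "refl_on (paths G) (path_cong G)"
    by (rule refl_onI) (rule path_cong.refl)
  show "sym (path_cong G)"
    by (rule symI) (rule path_cong.sym)
  show "trans (path_cong G)"
    by (rule transI) (rule path_cong.trans)
qed

lemma path_length_cases [consumes 1, case_names singleton long]:
  assumes "p \<in> paths G"
  obtains c where "p = [c]" | "length p \<ge> 2"
  using assms by (cases p rule: remdups_adj.cases) (auto simp: paths_def)

text \<open>
  The generating pairs concern paths of length at least two, but a path of length one is its own
  parallel edge. Edges parallel to a path can thus be treated without regard to its length.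
\<close>

lemma path_cong_edge:
  assumes "p \<in> paths G" "path_edge p \<in> G"
  shows "(p, [path_edge p]) \<in> path_cong G"
  using assms(1)
proof (cases rule: path_length_cases)
  case (singleton c)
  then show ?thesis using path_cong.refl[OF assms(1)] by simp
next
  case long
  then show ?thesis by (rule path_cong.gen[OF assms(1) _ assms(2)])
qed

context labelled_graph_restrictions
begin

lemma res_path_edge:
  assumes "p \<in> paths G" "path_edge p \<in> G" "g \<le> path_src p"
  shows "res g (path_edge p) = path_edge (path_res res g p)"
  using assms(1)
proof (cases rule: path_length_cases)
  case long
  then show ?thesis
    using R4[OF assms(1) long assms(2,3)] path_res_path[OF assms(1,3)] by (simp add: path_edge_def)
qed simp

text \<open>
  Restriction maps a generating pair to a generating pair, because the restriction of the parallel
  edge is again parallel to the restricted path; and congruent first factors restrict to paths with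
  the same target, so that their second factors are restricted to the same vertex. The argument for
  corestriction is the mirror image, starting from the last factor.
\<close>

lemma path_cong_res:
  assumes "(p, q) \<in> path_cong G" "g \<le> path_src p"
  shows "(path_res res g p, path_res res g q) \<in> path_cong G"
  using assms
proof (induction arbitrary: g)
  case (gen p)
  then show ?case
    using res_edge(1)[of "path_edge p" g] path_cong_edge[of "path_res res g p" G]
    by (simp add: res_path_edge path_res_in_paths)
next
  case (refl p)
  then show ?case by (simp add: path_cong.refl path_res_in_paths)
next
  case (sym p q)
  then show ?case using path_cong_invariants[OF sym.hyps] by (simp add: path_cong.sym)
next
  case (trans p q r)
  then show ?case using path_cong_invariants[OF trans.hyps(1)] by (metis path_cong.trans)
next
  case (comp p p' q q')
  note p = path_cong_invariants[OF comp.hyps(1)] and q = path_cong_invariants[OF comp.hyps(2)]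
  have ne: "p \<noteq> []" "p' \<noteq> []" "q \<noteq> []"
    using p q by (auto dest: paths_nonempty)
  have g: "g \<le> path_src p"
    using comp.prems ne by simp
  note IH = comp.IH(1)[OF g]
  have tgt: "path_tgt (path_res res g p) = path_tgt (path_res res g p')"
    using path_cong_invariants[OF IH] by simp
  have le: "path_tgt (path_res res g p) \<le> path_src q"
    using path_tgt_res_le[of p g] p g comp.hyps(3) by simp
  have "path_tgt (path_res res g p) = path_src (path_res res (path_tgt (path_res res g p)) q)"
    using path_src_res[of q] q le by simp
  then show ?case
    using path_cong.comp[OF IH comp.IH(2)[OF le]] ne tgt by (simp add: path_res_append)
qed

end

context labelled_graph_corestrictions
begin

lemma cor_path_edge:
  assumes "p \<in> paths G" "path_edge p \<in> G" "g \<le> path_tgt p"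
  shows "cor (path_edge p) g = path_edge (path_cor cor p g)"
  using assms(1)
proof (cases rule: path_length_cases)
  case long
  then show ?thesis
    using CR4[OF assms(1) long assms(2,3)] path_cor_path[OF assms(1,3)] by (simp add: path_edge_def)
qed simp

lemma path_cong_cor:
  assumes "(p, q) \<in> path_cong G" "g \<le> path_tgt p"
  shows "(path_cor cor p g, path_cor cor q g) \<in> path_cong G"
  using assms
proof (induction arbitrary: g)
  case (gen p)
  then show ?case
    using cor_edge(1)[of "path_edge p" g] path_cong_edge[of "path_cor cor p g" G]
    by (simp add: cor_path_edge path_cor_in_paths)
next
  case (refl p)
  then show ?case by (simp add: path_cong.refl path_cor_in_paths)
next
  case (sym p q)
  then show ?case using path_cong_invariants[OF sym.hyps] by (simp add: path_cong.sym)
next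
  case (trans p q r)
  then show ?case using path_cong_invariants[OF trans.hyps(1)] by (metis path_cong.trans)
next
  case (comp p p' q q')
  note p = path_cong_invariants[OF comp.hyps(1)] and q = path_cong_invariants[OF comp.hyps(2)]
  have ne: "p \<noteq> []" "q \<noteq> []" "q' \<noteq> []"
    using p q by (auto dest: paths_nonempty)
  have g: "g \<le> path_tgt q"
    using comp.prems ne by simp
  note IH = comp.IH(2)[OF g]
  have src: "path_src (path_cor cor q g) = path_src (path_cor cor q' g)"
    using path_cong_invariants[OF IH] by simp
  have le: "path_src (path_cor cor q g) \<le> path_tgt p"
    using path_src_cor_le[of q g] q g comp.hyps(3) by simp
  have "path_tgt (path_cor cor p (path_src (path_cor cor q g))) = path_src (path_cor cor q g)"
    using path_tgt_cor[of p] p le by simp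
  then show ?case
    using path_cong.comp[OF comp.IH(1)[OF le] IH] ne src by (simp add: path_cor_append)
qed

end

lemma (in compatible_labelled_graph) path_cong_mult:
  assumes "(p, p') \<in> path_cong G" "(q, q') \<in> path_cong G"
  shows "(p \<star> q, p' \<star> q') \<in> path_cong G"
proof -
  note p = path_cong_invariants[OF assms(1)] and q = path_cong_invariants[OF assms(2)]
  define m where "m = inf (path_tgt p) (path_src q)"
  have m: "m \<le> path_tgt p" "m \<le> path_src q"
    by (simp_all add: m_def)
  have "path_tgt (path_cor cor p m) = path_src (path_res res m q)"
    using p q m by (simp add: path_tgt_cor path_src_res)
  then show ?thesis
    using path_cong.comp[OF path_cong_cor[OF assms(1) m(1)] path_cong_res[OF assms(2) m(2)]] p q
    by (simp add: path_mult_def m_def)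
qed


section \<open>Arrows\<close>

lemma arrow_cases [consumes 1, case_names arrow_of]:
  assumes "c \<in> arrows G"
  obtains p where "p \<in> paths G" "c = arrow_of G p"
  using assms by (auto simp: arrows_def arrow_of_def quotient_def)

lemma arrow_of_in_arrows [simp]: "p \<in> paths G \<Longrightarrow> arrow_of G p \<in> arrows G"
  by (auto simp: arrows_def arrow_of_def quotient_def)

lemma arrow_of_eq_iff:
  "p \<in> paths G \<Longrightarrow> q \<in> paths G \<Longrightarrow> arrow_of G p = arrow_of G q \<longleftrightarrow> (p, q) \<in> path_cong G"
  unfolding arrow_of_def using eq_equiv_class_iff[OF path_cong_equiv] .

lemma arrow_of_eqI: "(p, q) \<in> path_cong G \<Longrightarrow> arrow_of G p = arrow_of G q"
  unfolding arrow_of_def by (rule equiv_class_eq[OF path_cong_equiv])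

lemma mem_arrow_of: "q \<in> arrow_of G p \<longleftrightarrow> (p, q) \<in> path_cong G"
  by (simp add: arrow_of_def)

lemma arrow_of_self: "p \<in> paths G \<Longrightarrow> p \<in> arrow_of G p"
  by (simp add: mem_arrow_of path_cong.refl)

lemma arrow_of_invariant:
  assumes "p \<in> paths G" "\<And>q. (p, q) \<in> path_cong G \<Longrightarrow> f q = f p"
  shows "the_elem (f ` arrow_of G p) = f p"
proof -
  have "f q = f p" if "q \<in> arrow_of G p" for q
    using assms(2) that by (simp add: mem_arrow_of)
  then have "f ` arrow_of G p = {f p}"
    using arrow_of_self[OF assms(1)] by blast
  then show ?thesis by simp
qed

lemma arrow_src_of [simp]: "p \<in> paths G \<Longrightarrow> arrow_src (arrow_of G p) = path_src p"
  unfolding arrow_src_def by (rule arrow_of_invariant) (auto dest: path_cong_invariants)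

lemma arrow_tgt_of [simp]: "p \<in> paths G \<Longrightarrow> arrow_tgt (arrow_of G p) = path_tgt p"
  unfolding arrow_tgt_def by (rule arrow_of_invariant) (auto dest: path_cong_invariants)

lemma arrow_lab_of [simp]: "p \<in> paths G \<Longrightarrow> arrow_lab (arrow_of G p) = path_lab p"
  unfolding arrow_lab_def by (rule arrow_of_invariant) (auto dest: path_cong_invariants)

lemma UN_arrow_of:
  assumes "p \<in> paths G" "\<And>q. (p, q) \<in> path_cong G \<Longrightarrow> F q = F p"
  shows "(\<Union>q\<in>arrow_of G p. F q) = F p"
proof -
  have "F q = F p" if "q \<in> arrow_of G p" for q
    using assms(2) that by (simp add: mem_arrow_of)
  then show ?thesis
    using arrow_of_self[OF assms(1)] by blast
qed

lemma arrow_comp_of: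
  assumes "p \<in> paths G" "q \<in> paths G" "path_tgt p = path_src q"
  shows "arrow_comp G (arrow_of G p) (arrow_of G q) = arrow_of G (p @ q)"
proof -
  define F where "F p' = (\<Union>q'\<in>arrow_of G q. arrow_of G (p' @ q'))" for p'
  have F: "F p' = arrow_of G (p @ q)" if p': "(p, p') \<in> path_cong G" for p'
  proof -
    have "arrow_of G (p' @ q') = arrow_of G (p' @ q)" if q': "(q, q') \<in> path_cong G" for q'
      using path_cong_invariants[OF p'] path_cong_invariants[OF q'] assms(3)
      by (intro arrow_of_eqI path_cong.comp path_cong.refl path_cong.sym[OF q']) simp_all
    then have "F p' = arrow_of G (p' @ q)"
      unfolding F_def by (rule UN_arrow_of[OF assms(2)])
    also have "\<dots> = arrow_of G (p @ q)"
      using path_cong_invariants[OF p'] assms(2,3)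
      by (intro arrow_of_eqI path_cong.comp path_cong.refl path_cong.sym[OF p']) simp_all
    finally show ?thesis .
  qed
  have Fp: "F p = arrow_of G (p @ q)"
    by (rule F[OF path_cong.refl[OF assms(1)]])
  have "(\<Union>p'\<in>arrow_of G p. F p') = F p"
    using F Fp by (intro UN_arrow_of[OF assms(1)]) simp
  then show ?thesis
    using Fp by (simp add: arrow_comp_def F_def)
qed

text \<open>
  Source, target and label are invariants of a class. Hence a class contains at most one edge, and it
  does contain one as soon as the triple of its invariants is an edge.
\<close>

lemma arrow_of_edge_inj:
  assumes "c \<in> G" "d \<in> G" "arrow_of G [c] = arrow_of G [d]"
  shows "c = d"
  using path_cong_invariants[of "[c]" "[d]" G] assms by (simp add: arrow_of_eq_iff prod_eq_iff)

lemma arrow_eq_edge: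
  assumes "x \<in> arrows G" "c \<in> G" "arrow_src x = edge_src c" "arrow_tgt x = edge_tgt c"
    "arrow_lab x = edge_lab c"
  shows "x = arrow_of G [c]"
  using assms(1)
proof (cases rule: arrow_cases)
  case (arrow_of p)
  have "path_edge p = c"
    using assms arrow_of by (simp add: path_edge_def)
  then show ?thesis
    using path_cong_edge[of p G] arrow_of assms(2) by (metis arrow_of_eqI)
qed

text \<open>
  The product of the loop \<open>(e, 1, e)\<close> and an edge \<open>(e, t, f)\<close> has that edge as parallel edge, so loops
  are absorbed by the first or the last edge of a path.
\<close>

lemma (in labelled_graph) loop_cong:
  assumes p: "p \<in> paths G"
  shows "arrow_of G ((path_src p, 1, path_src p) # p) = arrow_of G p"
    "arrow_of G (p @ [(path_tgt p, 1, path_tgt p)]) = arrow_of G p"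
proof -
  have edge: "([(edge_src c, 1, edge_src c), c], [c]) \<in> path_cong G"
    "([c, (edge_tgt c, 1, edge_tgt c)], [c]) \<in> path_cong G" if "c \<in> G" for c
    using that loops path_cong_edge[of "[(edge_src c, 1, edge_src c), c]" G]
      path_cong_edge[of "[c, (edge_tgt c, 1, edge_tgt c)]" G]
    by (simp_all add: paths_Cons path_edge_def)
  obtain c q where q: "p = c # q"
    using paths_nonempty[OF p] by (cases p) auto
  have c: "c \<in> G"
    using p by (simp add: q paths_Cons)
  have "([(edge_src c, 1, edge_src c), c] @ q, [c] @ q) \<in> path_cong G"
  proof (cases "q = []")
    case False
    then have "q \<in> paths G" "edge_tgt c = path_src q"
      using p by (simp_all add: q paths_Cons)
    then show ?thesis
      by (intro path_cong.comp edge(1)[OF c] path_cong.refl) simp_all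
  qed (use edge(1)[OF c] in simp)
  then show "arrow_of G ((path_src p, 1, path_src p) # p) = arrow_of G p"
    by (intro arrow_of_eqI) (simp add: q)
  obtain d r where r: "p = r @ [d]"
    using paths_nonempty[OF p] by (cases p rule: rev_cases) auto
  have d: "d \<in> G"
    using p by (cases "r = []") (simp_all add: r paths_append)
  have "(r @ [d, (edge_tgt d, 1, edge_tgt d)], r @ [d]) \<in> path_cong G"
  proof (cases "r = []")
    case False
    then have "r \<in> paths G" "path_tgt r = edge_src d"
      using p by (simp_all add: r paths_append)
    then show ?thesis
      by (intro path_cong.comp edge(2)[OF d] path_cong.refl) simp_all
  qed (use edge(2)[OF d] in simp)
  then show "arrow_of G (p @ [(path_tgt p, 1, path_tgt p)]) = arrow_of G p"
    by (intro arrow_of_eqI) (simp add: r)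
qed


section \<open>The Ehresmann semigroup of arrows\<close>

context compatible_labelled_graph
begin

abbreviation arrow_semigroup :: "('e, 't) edge list set biunary" ("\<S>") where
  "\<S> \<equiv> graph_product G res cor"

abbreviation unit_arrow :: "'e \<Rightarrow> ('e, 't) edge list set" where
  "unit_arrow e \<equiv> arrow_of G [(e, 1, e)]"

lemma unit_arrow_inj: "unit_arrow e = unit_arrow f \<longleftrightarrow> e = f"
  using arrow_of_edge_inj[of "(e, 1, e)" G "(f, 1, f)"] loops by auto

lemma carrier_arrow_semigroup: "carrier \<S> = arrows G"
  by (simp add: graph_product_def)

lemma lproj_arrow: "lproj \<S> c = unit_arrow (arrow_src c)"
  by (simp add: graph_product_def)

lemma rproj_arrow: "rproj \<S> c = unit_arrow (arrow_tgt c)"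
  by (simp add: graph_product_def)

lemma arrow_res_of:
  assumes "p \<in> paths G" "g \<le> path_src p"
  shows "arrow_res G res g (arrow_of G p) = arrow_of G (path_res res g p)"
  unfolding arrow_res_def using assms
  by (intro UN_arrow_of arrow_of_eqI path_cong.sym[OF path_cong_res]) auto

lemma arrow_cor_of:
  assumes "p \<in> paths G" "g \<le> path_tgt p"
  shows "arrow_cor G cor (arrow_of G p) g = arrow_of G (path_cor cor p g)"
  unfolding arrow_cor_def using assms
  by (intro UN_arrow_of arrow_of_eqI path_cong.sym[OF path_cong_cor]) auto

lemma arrow_mult_of:
  assumes "p \<in> paths G" "q \<in> paths G"
  shows "arrow_of G p \<odot>\<^bsub>\<S>\<^esub> arrow_of G q = arrow_of G (p \<star> q)"
  using assms path_cor_path[OF assms(1), of "inf (path_tgt p) (path_src q)"]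
    path_res_path[OF assms(2), of "inf (path_tgt p) (path_src q)"]
  by (simp add: graph_product_def arrow_res_of arrow_cor_of arrow_comp_of path_mult_def)

lemma arrow_mult_matching:
  assumes "p \<in> paths G" "q \<in> paths G" "path_tgt p = path_src q"
  shows "arrow_of G p \<odot>\<^bsub>\<S>\<^esub> arrow_of G q = arrow_of G (p @ q)"
  using arrow_mult_of[OF assms(1,2)] assms path_cor_tgt[OF assms(1)] path_res_src[OF assms(2)]
  by (simp add: path_mult_def)

lemma unit_arrow_mult:
  assumes "d \<in> arrows G"
  shows "unit_arrow e \<odot>\<^bsub>\<S>\<^esub> d = arrow_res G res (inf e (arrow_src d)) d"
  using assms
proof (cases rule: arrow_cases)
  case (arrow_of p)
  let ?m = "inf e (path_src p)"
  have "[(e, 1, e)] \<star> p = (?m, 1, ?m) # path_res res ?m p"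
    using CR5[of ?m e] by (simp add: path_mult_def)
  then show ?thesis
    using arrow_of loop_cong(1)[of "path_res res ?m p"]
    by (simp add: arrow_mult_of loops arrow_res_of path_res_in_paths path_src_res)
qed

lemma mult_unit_arrow:
  assumes "c \<in> arrows G"
  shows "c \<odot>\<^bsub>\<S>\<^esub> unit_arrow f = arrow_cor G cor c (inf (arrow_tgt c) f)"
  using assms
proof (cases rule: arrow_cases)
  case (arrow_of p)
  let ?m = "inf (path_tgt p) f"
  have "p \<star> [(f, 1, f)] = path_cor cor p ?m @ [(?m, 1, ?m)]"
    using R5[of ?m f] by (simp add: path_mult_def)
  then show ?thesis
    using arrow_of loop_cong(2)[of "path_cor cor p ?m"]
    by (simp add: arrow_mult_of loops arrow_cor_of path_cor_in_paths path_tgt_cor)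
qed

lemma unit_arrow_mult_unit_arrow: "unit_arrow e \<odot>\<^bsub>\<S>\<^esub> unit_arrow f = unit_arrow (inf e f)"
  using unit_arrow_mult[of "unit_arrow f" e] loops R5[of "inf e f" f]
  by (simp add: arrow_res_of)

lemma arrow_res_src: "c \<in> arrows G \<Longrightarrow> arrow_res G res (arrow_src c) c = c"
  by (auto elim!: arrow_cases simp: arrow_res_of path_res_src)

lemma arrow_cor_tgt: "c \<in> arrows G \<Longrightarrow> arrow_cor G cor c (arrow_tgt c) = c"
  by (auto elim!: arrow_cases simp: arrow_cor_of path_cor_tgt)

lemma arrow_res_in_arrows: "c \<in> arrows G \<Longrightarrow> g \<le> arrow_src c \<Longrightarrow> arrow_res G res g c \<in> arrows G"
  by (auto elim!: arrow_cases simp: arrow_res_of path_res_in_paths)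

text \<open>
  The mixed laws \<open>(xy)\<^sup>+ = (xy\<^sup>+)\<^sup>+\<close> and \<open>(xy)\<^sup>* = (x\<^sup>*y)\<^sup>*\<close> hold because the source of \<open>xy\<close> is that of a
  corestriction of \<open>x\<close>, which depends on \<open>y\<close> only through its source, and dually.
\<close>

theorem ehresmann_arrow_semigroup: "ehresmann_semigroup \<S>"
proof
  fix x y
  assume "x \<in> carrier \<S>" "y \<in> carrier \<S>"
  then have xy: "x \<in> arrows G" "y \<in> arrows G"
    by (simp_all add: carrier_arrow_semigroup)
  then obtain p q where p: "p \<in> paths G" "x = arrow_of G p" and q: "q \<in> paths G" "y = arrow_of G q"
    by (auto elim!: arrow_cases)
  let ?m = "inf (path_tgt p) (path_src q)"
  show "x \<odot>\<^bsub>\<S>\<^esub> y \<in> carrier \<S>"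
    using p q by (simp add: arrow_mult_of path_mult_in_paths carrier_arrow_semigroup)
  show "lproj \<S> (x \<odot>\<^bsub>\<S>\<^esub> y) = lproj \<S> (x \<odot>\<^bsub>\<S>\<^esub> lproj \<S> y)"
    using p q xy(1) by (simp add: lproj_arrow arrow_mult_of path_mult_in_paths path_src_mult
        mult_unit_arrow arrow_cor_of path_cor_in_paths)
  show "rproj \<S> (x \<odot>\<^bsub>\<S>\<^esub> y) = rproj \<S> (rproj \<S> x \<odot>\<^bsub>\<S>\<^esub> y)"
    using p q xy(2) by (simp add: rproj_arrow arrow_mult_of path_mult_in_paths path_tgt_mult
        unit_arrow_mult arrow_res_of path_res_in_paths)
  fix z
  assume "z \<in> carrier \<S>"
  then obtain r where r: "r \<in> paths G" "z = arrow_of G r"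
    by (auto elim!: arrow_cases simp: carrier_arrow_semigroup)
  show "x \<odot>\<^bsub>\<S>\<^esub> y \<odot>\<^bsub>\<S>\<^esub> z = x \<odot>\<^bsub>\<S>\<^esub> (y \<odot>\<^bsub>\<S>\<^esub> z)"
    using p q r by (simp add: arrow_mult_of path_mult_in_paths path_mult_assoc)
qed (simp_all add: lproj_arrow rproj_arrow carrier_arrow_semigroup unit_arrow_mult_unit_arrow
    inf_commute unit_arrow_mult mult_unit_arrow arrow_res_src arrow_cor_tgt loops)

sublocale ehresmann_semigroup \<S>
  by (rule ehresmann_arrow_semigroup)


section \<open>Projections and the natural orders\<close>

lemma projections_arrow: "projections \<S> = range unit_arrow"
proof -
  have "unit_arrow e \<in> projections \<S>" for e
    using lproj_in_projections[of "unit_arrow e"] loops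
    by (simp add: lproj_arrow carrier_arrow_semigroup)
  then show ?thesis
    by (auto simp: projections_def lproj_arrow)
qed

lemma arrow_src_projections_iso:
  "bij_betw arrow_src (projections \<S>) UNIV"
  "x \<in> projections \<S> \<Longrightarrow> y \<in> projections \<S> \<Longrightarrow>
   arrow_src (x \<odot>\<^bsub>\<S>\<^esub> y) = inf (arrow_src x) (arrow_src y)"
  using loops
  by (auto simp: projections_arrow bij_betw_def inj_on_def image_image unit_arrow_mult_unit_arrow)

text \<open>
  An identity \<open>u\<close> satisfies \<open>u [(e,1,e)] = [(e,1,e)]\<close> for every vertex \<open>e\<close>, so the source \<open>e\<close> of the
  product lies below the source of \<open>u\<close>, which is therefore the maximum.
\<close>

lemma arrow_semigroup_is_monoid_iff: "is_monoid \<S> \<longleftrightarrow> (\<exists>m::'e. \<forall>e. e \<le> m)"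
proof
  assume "is_monoid \<S>"
  then obtain u where u: "monoid \<lparr>carrier = carrier \<S>, mult = bmult \<S>, one = u\<rparr>"
    by (auto simp: is_monoid_def)
  have "u \<in> arrows G"
    using monoid.one_closed[OF u] by (simp add: carrier_arrow_semigroup)
  then obtain p where p: "p \<in> paths G" "u = arrow_of G p"
    by (auto elim!: arrow_cases)
  have "e \<le> path_src p" for e
  proof -
    have "u \<odot>\<^bsub>\<S>\<^esub> unit_arrow e = unit_arrow e"
      using monoid.l_one[OF u, of "unit_arrow e"] loops by (simp add: carrier_arrow_semigroup)
    then have "arrow_src (arrow_of G (p \<star> [(e, 1, e)])) = e"
      using p loops by (simp add: arrow_mult_of)
    then show ?thesis
      using p loops path_src_cor_le[OF p(1), of "inf (path_tgt p) e"]
      by (simp add: path_mult_in_paths path_src_mult)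
  qed
  then show "\<exists>m::'e. \<forall>e. e \<le> m"
    by blast
next
  assume "\<exists>m::'e. \<forall>e. e \<le> m"
  then obtain m :: 'e where m: "\<And>e. e \<le> m"
    by blast
  have "monoid \<lparr>carrier = carrier \<S>, mult = bmult \<S>, one = unit_arrow m\<rparr>"
    using m loops
    by (intro monoidI) (simp_all add: bmult_closed bmult_assoc, simp_all add:
        carrier_arrow_semigroup unit_arrow_mult mult_unit_arrow inf.absorb1 inf.absorb2
        arrow_res_src arrow_cor_tgt)
  then show "is_monoid \<S>"
    by (auto simp: is_monoid_def)
qed

lemma le_l_arrow_iff:
  assumes "d \<in> arrows G"
  shows "le_l \<S> c d \<longleftrightarrow> (\<exists>e\<le>arrow_src d. c = arrow_res G res e d)"
proof
  assume "le_l \<S> c d"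
  then show "\<exists>e\<le>arrow_src d. c = arrow_res G res e d"
    using assms by (auto simp: le_l_def projections_arrow unit_arrow_mult intro: inf_le2)
next
  assume "\<exists>e\<le>arrow_src d. c = arrow_res G res e d"
  then obtain e where "e \<le> arrow_src d" "c = unit_arrow e \<odot>\<^bsub>\<S>\<^esub> d"
    using assms by (auto simp: unit_arrow_mult inf.absorb1)
  then show "le_l \<S> c d"
    by (auto simp: le_l_def projections_arrow)
qed

lemma le_r_arrow_iff:
  assumes "d \<in> arrows G"
  shows "le_r \<S> c d \<longleftrightarrow> (\<exists>f\<le>arrow_tgt d. c = arrow_cor G cor d f)"
proof
  assume "le_r \<S> c d"
  then show "\<exists>f\<le>arrow_tgt d. c = arrow_cor G cor d f"
    using assms by (auto simp: le_r_def projections_arrow mult_unit_arrow intro: inf_le1)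
next
  assume "\<exists>f\<le>arrow_tgt d. c = arrow_cor G cor d f"
  then obtain f where "f \<le> arrow_tgt d" "c = d \<odot>\<^bsub>\<S>\<^esub> unit_arrow f"
    using assms by (auto simp: mult_unit_arrow inf.absorb2)
  then show "le_r \<S> c d"
    by (auto simp: le_r_def projections_arrow)
qed

lemma le_nat_iff_le_l_le_r: "le_nat \<S> c d \<longleftrightarrow> (\<exists>b. le_l \<S> b d \<and> le_r \<S> c b)"
  by (auto simp: le_nat_def le_l_def le_r_def)

lemma le_nat_arrow_iff:
  assumes "d \<in> arrows G"
  shows "le_nat \<S> c d \<longleftrightarrow>
    (\<exists>e\<le>arrow_src d. \<exists>f\<le>arrow_tgt (arrow_res G res e d).
       c = arrow_cor G cor (arrow_res G res e d) f)"
proof -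
  have "le_nat \<S> c d \<longleftrightarrow> (\<exists>e\<le>arrow_src d. le_r \<S> c (arrow_res G res e d))"
    using assms by (auto simp: le_nat_iff_le_l_le_r le_l_arrow_iff)
  then show ?thesis
    using le_r_arrow_iff[OF arrow_res_in_arrows[OF assms]] by auto
qed


section \<open>Labels and \<open>\<sigma>\<close>\<close>

lemma arrow_lab_mult:
  assumes "c \<in> arrows G" "d \<in> arrows G"
  shows "arrow_lab (c \<odot>\<^bsub>\<S>\<^esub> d) = arrow_lab c * arrow_lab d"
  using assms by (auto elim!: arrow_cases simp: arrow_mult_of path_mult_in_paths path_lab_mult)

text \<open>
  Having the same label is a congruence that identifies all projections, their label being \<open>1\<close>.
\<close>

lemma sigma_arrow_lab:
  assumes "(c, d) \<in> sigma \<S>"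
  shows "arrow_lab c = arrow_lab d"
proof -
  let ?\<rho> = "{(c, d). c \<in> arrows G \<and> d \<in> arrows G \<and> arrow_lab c = arrow_lab d}"
  have "equiv (carrier \<S>) ?\<rho>"
    by (auto intro!: equivI refl_onI symI transI simp: carrier_arrow_semigroup)
  moreover have "c \<odot>\<^bsub>\<S>\<^esub> d \<in> arrows G" if "c \<in> arrows G" "d \<in> arrows G" for c d
    using bmult_closed that by (simp add: carrier_arrow_semigroup)
  ultimately have "congruence \<S> ?\<rho>"
    unfolding congruence_def by (simp add: arrow_lab_mult lproj_arrow rproj_arrow loops)
  moreover have "projections \<S> \<times> projections \<S> \<subseteq> ?\<rho>"
    by (auto simp: projections_arrow loops)
  ultimately have "sigma \<S> \<subseteq> ?\<rho>"
    by (rule sigma_least)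
  then show ?thesis
    using assms by blast
qed

lemma arrow_lab_surj: "arrow_lab ` arrows G = UNIV"
proof -
  have "t \<in> arrow_lab ` arrows G" for t
  proof -
    obtain p where "p \<in> paths G" "path_lab p = t"
      using labels by blast
    then show ?thesis
      by (intro image_eqI[of _ _ "arrow_of G p"]) simp_all
  qed
  then show ?thesis by blast
qed

lemma sigma_quotient_arrow_iso:
  assumes "\<And>c d. c \<in> arrows G \<Longrightarrow> d \<in> arrows G \<Longrightarrow> (c, d) \<in> sigma \<S> \<longleftrightarrow> arrow_lab c = arrow_lab d"
  shows "sigma_quotient \<S> \<cong> (monoid_of_class :: 't monoid)"
proof (rule sigma_quotient_iso)
  show "arrow_lab ` carrier \<S> = carrier (monoid_of_class :: 't monoid)"
    using arrow_lab_surj by (simp add: carrier_arrow_semigroup monoid_of_class_def)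
  show "monoid (monoid_of_class :: 't monoid)"
    by (rule monoidI) (simp_all add: monoid_of_class_def mult.assoc)
qed (simp_all add: carrier_arrow_semigroup monoid_of_class_def arrow_lab_mult assms)


section \<open>The edges as a proper generating ideal\<close>

abbreviation edge_arrow :: "('e, 't) edge \<Rightarrow> ('e, 't) edge list set" where
  "edge_arrow c \<equiv> arrow_of G [c]"

text \<open>
  An edge is determined by its two projections and its label, and the label is an invariant of
  the \<open>\<sigma>\<close>-class.
\<close>

lemma edge_arrow_proper:
  assumes "c \<in> G"
  shows "edge_arrow c \<in> proper_elements \<S>"
proof -
  have "t = edge_arrow c"
    if "t \<in> arrows G" "lproj \<S> t = lproj \<S> (edge_arrow c)" "rproj \<S> t = rproj \<S> (edge_arrow c)"
      "(t, edge_arrow c) \<in> sigma \<S>" for t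
    using that assms sigma_arrow_lab[OF that(4)]
    by (intro arrow_eq_edge) (simp_all add: lproj_arrow rproj_arrow unit_arrow_inj)
  then show ?thesis
    using assms by (simp add: proper_elements_def carrier_arrow_semigroup)
qed

lemma order_ideal_edge_arrows: "order_ideal \<S> (edge_arrow ` G)"
  unfolding order_ideal_def
proof (intro conjI ballI impI)
  show "edge_arrow ` G \<subseteq> carrier \<S>"
    by (auto simp: carrier_arrow_semigroup)
next
  fix y x assume "y \<in> edge_arrow ` G" "le_nat \<S> x y"
  then obtain c where c: "c \<in> G" and "le_nat \<S> x (edge_arrow c)"
    by blast
  then obtain e f where e: "e \<le> edge_src c"
      and f: "f \<le> arrow_tgt (arrow_res G res e (edge_arrow c))"
      and x: "x = arrow_cor G cor (arrow_res G res e (edge_arrow c)) f"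
    by (auto simp: le_nat_arrow_iff)
  have "arrow_res G res e (edge_arrow c) = edge_arrow (res e c)"
    using c e by (simp add: arrow_res_of)
  then have "x = edge_arrow (cor (res e c) f)" "cor (res e c) f \<in> G"
    using c e f x by (simp_all add: res_edge(1) arrow_cor_of cor_edge(1))
  then show "x \<in> edge_arrow ` G"
    by blast
qed

lemma list_product_singleton [simp]: "list_product S [x] = x"
  by (simp add: list_product_def)

lemma list_product_snoc:
  "xs \<noteq> [] \<Longrightarrow> list_product S (xs @ [x]) = list_product S xs \<odot>\<^bsub>S\<^esub> x"
  by (simp add: list_product_def)

lemma list_product_edge_arrows:
  "p \<in> paths G \<Longrightarrow> list_product \<S> (map edge_arrow p) = arrow_of G p"
proof (induction p rule: rev_induct)
  case (snoc c p)
  then show ?case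
    by (cases "p = []") (simp_all add: paths_append list_product_snoc arrow_mult_matching)
qed (simp add: paths_def)

text \<open>
  Neighbouring edges of a list match as arrows exactly when they meet in the graph, so the matching
  factorizations of an arrow into edges are the paths that represent it.
\<close>

lemma edge_factorizations:
  "matching_factorization_into \<S> (edge_arrow ` G) s xs \<longleftrightarrow>
   (\<exists>p\<in>paths G. xs = map edge_arrow p \<and> s = arrow_of G p)"
proof -
  have match: "successively (\<lambda>a b. rproj \<S> a = lproj \<S> b) (map edge_arrow p) \<longleftrightarrow>
      successively (\<lambda>a b. edge_tgt a = edge_src b) p" if "set p \<subseteq> G" for p
    unfolding successively_map using that
    by (intro successively_cong) (auto simp: lproj_arrow rproj_arrow unit_arrow_inj subset_iff)
  show ?thesis
  proof
    assume xs: "matching_factorization_into \<S> (edge_arrow ` G) s xs"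
    then have "xs \<in> lists (edge_arrow ` G)"
      by (auto simp: matching_factorization_into_def)
    then obtain p where p: "set p \<subseteq> G" "xs = map edge_arrow p"
      by (auto simp: lists_image)
    then have "p \<in> paths G"
      using xs match[OF p(1)]
      by (auto simp: paths_def matching_factorization_into_def matching_factorization_def)
    then show "\<exists>p\<in>paths G. xs = map edge_arrow p \<and> s = arrow_of G p"
      using xs p list_product_edge_arrows
      by (auto simp: matching_factorization_into_def matching_factorization_def)
  next
    assume "\<exists>p\<in>paths G. xs = map edge_arrow p \<and> s = arrow_of G p"
    then obtain p where p: "p \<in> paths G" "xs = map edge_arrow p" "s = arrow_of G p"
      by blast
    moreover have "set p \<subseteq> G" "p \<noteq> []"
      using p by (auto simp: paths_def)
    moreover have "successively (\<lambda>a b. rproj \<S> a = lproj \<S> b) (map edge_arrow p)"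
      using match[OF \<open>set p \<subseteq> G\<close>] p by (simp add: paths_def)
    ultimately show "matching_factorization_into \<S> (edge_arrow ` G) s xs"
      by (auto simp: matching_factorization_into_def matching_factorization_def
          list_product_edge_arrows carrier_arrow_semigroup)
  qed
qed

lemma path_cong_context:
  assumes "(p, q) \<in> path_cong G" "u @ p @ v \<in> paths G"
  shows "(u @ p @ v, u @ q @ v) \<in> path_cong G"
proof -
  note pq = path_cong_invariants[OF assms(1)]
  have ne: "p \<noteq> []" "q \<noteq> []"
    using pq paths_nonempty by blast+
  have right: "(p @ v, q @ v) \<in> path_cong G"
  proof (cases "v = []")
    case False
    then have "p @ v \<in> paths G"
      using assms(2) ne by (cases "u = []") (auto simp: paths_append)
    then show ?thesis
      using False ne assms(1) by (intro path_cong.comp path_cong.refl) (simp_all add: paths_append)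
  qed (use assms(1) in simp)
  show ?thesis
  proof (cases "u = []")
    case False
    then show ?thesis
      using right ne assms(2)
      by (intro path_cong.comp[OF path_cong.refl right]) (simp_all add: paths_append)
  qed (use right in simp)
qed

text \<open>
  Contracting a segment of a path to a parallel edge with the same label is a step between
  factorizations, as edges are proper. The path congruence is generated by such contractions in
  arbitrary contexts; stating the claim for all surrounding paths \<open>u\<close> and \<open>v\<close> is what makes the
  case of concatenation go through, where the two factors are rewritten one after the other.
\<close>

lemma path_cong_equivalent_factorizations:
  assumes "(p, q) \<in> path_cong G" "u @ p @ v \<in> paths G"
  shows "equivalent_factorizations \<S> (arrow_of G (u @ p @ v))
    (map edge_arrow (u @ p @ v)) (map edge_arrow (u @ q @ v))"
  using assms
proof (induction arbitrary: u v)
  case (gen p)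
  let ?s = "arrow_of G (u @ p @ v)"
  have "matching_factorization_into \<S> (edge_arrow ` G) ?s (map edge_arrow (u @ p @ v))"
    using edge_factorizations gen.prems by blast
  then have "matching_factorization_into \<S> (proper_elements \<S>) ?s (map edge_arrow (u @ p @ v))"
    using edge_arrow_proper by (auto simp: matching_factorization_into_def)
  moreover have "list_product \<S> (map edge_arrow p) = edge_arrow (path_edge p)"
    using gen.hyps list_product_edge_arrows[of p] arrow_of_eqI[OF path_cong.gen[of p]] by simp
  ultimately have "factorization_step \<S> ?s
      (map edge_arrow (u @ p @ v)) (map edge_arrow (u @ [path_edge p] @ v))"
    unfolding factorization_step_def
    using edge_arrow_proper[OF gen.hyps(3)] paths_nonempty[OF gen.hyps(1)]
    by (intro conjI exI[of _ "map edge_arrow u"] exI[of _ "map edge_arrow p"]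
        exI[of _ "map edge_arrow v"]) simp_all
  then show ?case
    unfolding equivalent_factorizations_def by (rule r_into_equivclp)
next
  case (refl p)
  then show ?case
    by (simp add: equivalent_factorizations_def)
next
  case (sym p q)
  note cong = path_cong_context[OF path_cong.sym[OF sym.hyps] sym.prems]
  then have "equivalent_factorizations \<S> (arrow_of G (u @ p @ v))
      (map edge_arrow (u @ p @ v)) (map edge_arrow (u @ q @ v))"
    using sym.IH[of u v] path_cong_invariants[OF cong] by simp
  then show ?case
    unfolding arrow_of_eqI[OF cong] equivalent_factorizations_def by (rule equivclp_sym)
next
  case (trans p q r)
  note cong = path_cong_context[OF trans.hyps(1) trans.prems]
  have "equivalent_factorizations \<S> (arrow_of G (u @ p @ v))
      (map edge_arrow (u @ q @ v)) (map edge_arrow (u @ r @ v))"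
    using trans.IH(2)[of u v] path_cong_invariants[OF cong] by (simp add: arrow_of_eqI[OF cong])
  then show ?case
    using trans.IH(1)[OF trans.prems] unfolding equivalent_factorizations_def
    by (meson equivclp_trans)
next
  case (comp p p' q q')
  have prems: "u @ p @ (q @ v) \<in> paths G"
    using comp.prems by simp
  note cong = path_cong_context[OF comp.hyps(1) prems]
  have "equivalent_factorizations \<S> (arrow_of G (u @ p @ (q @ v)))
      (map edge_arrow (u @ p @ (q @ v))) (map edge_arrow (u @ p' @ (q @ v)))"
    using comp.IH(1)[OF prems] .
  moreover have "equivalent_factorizations \<S> (arrow_of G (u @ p @ (q @ v)))
      (map edge_arrow ((u @ p') @ q @ v)) (map edge_arrow ((u @ p') @ q' @ v))"
    using comp.IH(2)[of "u @ p'" v] path_cong_invariants[OF cong]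
    by (simp add: arrow_of_eqI[OF cong])
  ultimately show ?case
    unfolding equivalent_factorizations_def append_assoc by (rule equivclp_trans)
qed

lemma proper_generating_ideal_edge_arrows: "proper_generating_ideal \<S> (edge_arrow ` G)"
  unfolding proper_generating_ideal_def
proof (intro conjI ballI allI impI)
  fix s assume "s \<in> carrier \<S>"
  then show "\<exists>xs. matching_factorization_into \<S> (edge_arrow ` G) s xs"
    unfolding edge_factorizations by (auto elim!: arrow_cases simp: carrier_arrow_semigroup)
next
  fix s xs ys
  assume "matching_factorization_into \<S> (edge_arrow ` G) s xs"
    "matching_factorization_into \<S> (edge_arrow ` G) s ys"
  then obtain p q where "p \<in> paths G" "xs = map edge_arrow p" "s = arrow_of G p"
    and "q \<in> paths G" "ys = map edge_arrow q" "s = arrow_of G q"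
    unfolding edge_factorizations by blast
  then show "equivalent_factorizations \<S> s xs ys"
    using path_cong_equivalent_factorizations[of p q "[]" "[]"] arrow_of_eq_iff[of p G q] by simp
qed (use order_ideal_edge_arrows edge_arrow_proper loops in \<open>auto simp: projections_arrow\<close>)

end


section \<open>The structure of the semigroup of arrows\<close>

theorem theorem3p11:
  fixes G :: "('e::semilattice_inf, 't::monoid_mult) edge set"
    and res :: "'e \<Rightarrow> ('e, 't) edge \<Rightarrow> ('e, 't) edge"
    and cor :: "('e, 't) edge \<Rightarrow> 'e \<Rightarrow> ('e, 't) edge"
  assumes "compatible_labelled_graph G res cor"
    and "S = graph_product G res cor"
  shows
    "\<comment> \<open>(1)\<close>
     ehresmann_semigroup S \<and>
     \<comment> \<open>(2)\<close>
     projections S = {arrow_of G [(e, 1, e)] | e. True} \<and>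
     (\<exists>\<phi>. (\<forall>e. \<phi> (arrow_of G [(e, 1, e)]) = e) \<and>
          bij_betw \<phi> (projections S) UNIV \<and>
          (\<forall>x\<in>projections S. \<forall>y\<in>projections S. \<phi> (x \<odot>\<^bsub>S\<^esub> y) = inf (\<phi> x) (\<phi> y))) \<and>
     (is_monoid S \<longleftrightarrow> (\<exists>m::'e. \<forall>e. e \<le> m)) \<and>
     \<comment> \<open>(3)\<close>
     (\<forall>c\<in>carrier S. \<forall>d\<in>carrier S. (c, d) \<in> sigma S \<longrightarrow> arrow_lab c = arrow_lab d) \<and>
     \<comment> \<open>(4)\<close>
     (\<forall>c\<in>carrier S. \<forall>d\<in>carrier S.
        (le_l S c d \<longleftrightarrow> (\<exists>e\<le>arrow_src d. c = arrow_res G res e d)) \<and>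
        (le_r S c d \<longleftrightarrow> (\<exists>f\<le>arrow_tgt d. c = arrow_cor G cor d f)) \<and>
        (le_nat S c d \<longleftrightarrow>
          (\<exists>e\<le>arrow_src d. \<exists>f\<le>arrow_tgt (arrow_res G res e d).
             c = arrow_cor G cor (arrow_res G res e d) f))) \<and>
     \<comment> \<open>(5)\<close>
     ((\<forall>c\<in>carrier S. \<forall>d\<in>carrier S. (c, d) \<in> sigma S \<longleftrightarrow> arrow_lab c = arrow_lab d) \<longrightarrow>
        proper_ehresmann_semigroup S \<and>
        proper_generating_ideal S {arrow_of G [c] | c. c \<in> G} \<and>
        monoid (sigma_quotient S) \<and> sigma_quotient S \<cong> (monoid_of_class :: 't monoid))"
proof -
  interpret compatible_labelled_graph G res cor
    by (rule assms(1))
  have "arrows G \<noteq> {}"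
    using arrow_lab_surj by blast
  then have quotient: "monoid (sigma_quotient S)"
    using sigma_quotient_monoid by (simp add: assms(2) carrier_arrow_semigroup)
  have edges: "{arrow_of G [c] | c. c \<in> G} = edge_arrow ` G"
    by blast
  show ?thesis
    unfolding assms(2) edges
  proof (intro conjI ballI impI)
    show "ehresmann_semigroup \<S>"
      by (rule ehresmann_arrow_semigroup)
    show "projections \<S> = {unit_arrow e | e. True}"
      by (auto simp: projections_arrow)
    show "\<exists>\<phi>. (\<forall>e. \<phi> (unit_arrow e) = e) \<and> bij_betw \<phi> (projections \<S>) UNIV \<and>
        (\<forall>x\<in>projections \<S>. \<forall>y\<in>projections \<S>. \<phi> (x \<odot>\<^bsub>\<S>\<^esub> y) = inf (\<phi> x) (\<phi> y))"
      using arrow_src_projections_iso loops by (intro exI[of _ arrow_src]) simp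
    show "is_monoid \<S> \<longleftrightarrow> (\<exists>m::'e. \<forall>e. e \<le> m)"
      by (rule arrow_semigroup_is_monoid_iff)
  next
    fix c d
    show "arrow_lab c = arrow_lab d" if "(c, d) \<in> sigma \<S>"
      using that by (rule sigma_arrow_lab)
    assume "d \<in> carrier \<S>"
    then have d: "d \<in> arrows G"
      by (simp add: carrier_arrow_semigroup)
    show "le_l \<S> c d \<longleftrightarrow> (\<exists>e\<le>arrow_src d. c = arrow_res G res e d)"
      by (rule le_l_arrow_iff[OF d])
    show "le_r \<S> c d \<longleftrightarrow> (\<exists>f\<le>arrow_tgt d. c = arrow_cor G cor d f)"
      by (rule le_r_arrow_iff[OF d])
    show "le_nat \<S> c d \<longleftrightarrow> (\<exists>e\<le>arrow_src d. \<exists>f\<le>arrow_tgt (arrow_res G res e d).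
        c = arrow_cor G cor (arrow_res G res e d) f)"
      by (rule le_nat_arrow_iff[OF d])
  next
    assume kernel: "\<forall>c\<in>carrier \<S>. \<forall>d\<in>carrier \<S>. (c, d) \<in> sigma \<S> \<longleftrightarrow> arrow_lab c = arrow_lab d"
    show "proper_ehresmann_semigroup \<S>"
      using ehresmann_arrow_semigroup proper_generating_ideal_edge_arrows
      by (auto simp: proper_ehresmann_semigroup_def)
    show "proper_generating_ideal \<S> (edge_arrow ` G)"
      by (rule proper_generating_ideal_edge_arrows)
    show "monoid (sigma_quotient \<S>)"
      using quotient by (simp add: assms(2))
    show "sigma_quotient \<S> \<cong> (monoid_of_class :: 't monoid)"
      using kernel by (intro sigma_quotient_arrow_iso) (simp add: carrier_arrow_semigroup)
  qed
qed

end
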